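(* a) Let $f\in H_{1/2}$ and $$\omega_{H_{1/2}}\left(\frac1{M_n},f\right)=o\left(\frac1{n^2}\right)\quad\text{when } n\to\infty .$$ Then $\|\sigma_nf-f\|_{H_{1/2}}\to0$ when $n\to\infty$. b) There exists a martingale $f\in H_{1/2}$ for which $$\omega_{H_{1/2}}\left(\frac1{M_n},f\right)=O\left(\frac1{n^2}\right)\quad\text{when } n\to\infty$$ and $\|\sigma_nf-f\|_{1/2}\nrightarrow0$ when $n\to\infty$.
   Context: $\mathbb N_+$ is the set of positive integers, $\mathbb N=\mathbb N_+\cup\{0\}$. Fix a bounded sequence $m=(m_0,m_1,\dots)$ of integers $m_k\ge 2$. $G_m=\prod_{k\ge0}Z_{m_k}$, where $Z_{m_k}=\{0,\dots,m_k-1\}$ is the additive group modulo $m_k$, with the product of the discrete topologies; $\mu$ is the Haar measure with $\mu(G_m)=1$. $M_0:=1$, $M_{k+1}:=m_kM_k$; every $n\in\mathbb N$ is uniquely $n=\sum_{j\ge0}n_jM_j$ with $n_j\in Z_{m_j}$. $r_k(x):=\exp(2\pi i x_k/m_k)$, $\psi_n:=\prod_{k\ge0}r_k^{n_k}$ (Vilenkin system). $I_0(x):=G_m$, $I_n(x):=\{y: y_0=x_0,\dots,y_{n-1}=x_{n-1}\}$; $\mathcal F_n$ is the $\sigma$-algebra generated by $\{I_n(x):x\in G_m\}$. For $g\in L_1(G_m)$: $\widehat g(k):=\int g\overline{\psi_k}\,d\mu$, $S_ng:=\sum_{k=0}^{n-1}\widehat g(k)\psi_k$. A martingale is a sequence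 $f=(f^{(n)}:n\in\mathbb N)$ of integrable functions with $f^{(n)}$ $\mathcal F_n$-measurable and $S_{M_n}f^{(k)}=f^{(n)}$ for $n\le k$; $f^*:=\sup_n|f^{(n)}|$; $H_p$ is the set of martingales with $\|f\|_{H_p}:=\|f^*\|_p<\infty$, where $\|g\|_p:=(\int|g|^pd\mu)^{1/p}$ for functions and $\|f\|_p:=\sup_n\|f^{(n)}\|_p$ for martingales. For a martingale, $\widehat f(i):=\lim_k\int f^{(k)}\overline{\psi_i}\,d\mu$, $S_nf:=\sum_{k=0}^{n-1}\widehat f(k)\psi_k$, and $\sigma_nf:=\frac1n\sum_{k=1}^nS_kf$ ($n\in\mathbb N_+$). A function $g\in L_1$ is identified with the martingale $(S_{M_k}g:k\in\mathbb N)$; thus $\sigma_nf-f$ is the martingale $(S_{M_k}\sigma_nf-f^{(k)}:k\in\mathbb N)$, and similarly for $f-S_{M_n}f$. The modulus of continuity in $H_p$ is $\omega_{H_p}(1/M_n,f):=\|f-S_{M_n}f\|_{H_p}$. *)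

theory Defs
  imports "HOL-Probability.Probability" "HOL-Number_Theory.Cong"
begin

section \<open>The Vilenkin group and its Haar measure\<close>

definition vgroup :: "(nat \<Rightarrow> nat) \<Rightarrow> (nat \<Rightarrow> nat) set" where
  "vgroup m = {x. \<forall>k. x k < m k}"

definition vtopology :: "(nat \<Rightarrow> nat) \<Rightarrow> (nat \<Rightarrow> nat) topology" where
  "vtopology m = product_topology (\<lambda>k. discrete_topology {..<m k}) UNIV"

text \<open>
  The normalized Haar measure of the product is the product of the normalized counting measures.
  That it is a Borel probability measure invariant under translations is proved below
  (\<open>sets_vmeasure\<close>, \<open>prob_space_vmeasure\<close>, \<open>vmeasure_translation_invariant\<close>).
\<close>

definition vmeasure :: "(nat \<Rightarrow> nat) \<Rightarrow> (nat \<Rightarrow> nat) measure" where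
  "vmeasure m = (\<Pi>\<^sub>M k\<in>UNIV. uniform_count_measure {..<m k})"

definition vinterval :: "(nat \<Rightarrow> nat) \<Rightarrow> nat \<Rightarrow> (nat \<Rightarrow> nat) \<Rightarrow> (nat \<Rightarrow> nat) set" where
  "vinterval m n x = {y \<in> vgroup m. \<forall>k<n. y k = x k}"

definition vfiltration :: "(nat \<Rightarrow> nat) \<Rightarrow> nat \<Rightarrow> (nat \<Rightarrow> nat) measure" where
  "vfiltration m n = sigma (vgroup m) {vinterval m n x | x. x \<in> vgroup m}"

lemma vgroup_eq_PiE: "vgroup m = (\<Pi>\<^sub>E k\<in>UNIV. {..<m k})"
  by (auto simp: vgroup_def PiE_def Pi_def)

lemma space_vmeasure [simp]: "space (vmeasure m) = vgroup m"
  by (simp add: vmeasure_def space_PiM vgroup_eq_PiE space_uniform_count_measure)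

lemma topspace_vtopology [simp]: "topspace (vtopology m) = vgroup m"
  by (simp add: vtopology_def vgroup_eq_PiE)

lemma prob_space_uniform_lessThan:
  assumes "\<And>k. 2 \<le> (m k :: nat)"
  shows "prob_space (uniform_count_measure {..<m k})"
proof (rule prob_space_uniform_count_measure)
  show "{..<m k} \<noteq> {}" using assms[of k] by (auto simp: lessThan_empty_iff)
qed simp

lemma prob_space_vmeasure:
  assumes "\<And>k. 2 \<le> m k"
  shows "prob_space (vmeasure m)"
  unfolding vmeasure_def
  by (intro prob_space_PiM prob_space_uniform_lessThan assms)

lemma openin_vinterval: "openin (vtopology m) (vinterval m n x)"
proof -
  define X where "X = (\<lambda>k. if k < n then {x k} \<inter> {..<m k} else {..<m k})"
  have eq: "vinterval m n x = Pi\<^sub>E UNIV X"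
    by (force simp: vinterval_def vgroup_def X_def PiE_def Pi_def split: if_splits)
  have "finite {k. X k \<noteq> {..<m k}}"
    by (rule finite_subset[of _ "{..<n}"]) (auto simp: X_def)
  then show ?thesis
    unfolding eq vtopology_def
    by (subst openin_PiE_gen) (auto simp: X_def)
qed

lemma sets_vmeasure_eq:
  "sets (vmeasure m) = sigma_sets (vgroup m)
     {{y \<in> vgroup m. y i \<in> A} | i A. A \<subseteq> {..<m i}}"
  unfolding vmeasure_def sets_PiM_single
  by (simp add: space_uniform_count_measure sets_uniform_count_measure vgroup_eq_PiE)

lemma vinterval_sets: "vinterval m n x \<in> sets (vmeasure m)"
proof -
  have *: "{y \<in> vgroup m. y k = x k} \<in> sets (vmeasure m)" for k
  proof -
    have "{y \<in> vgroup m. y k = x k} = {y \<in> vgroup m. y k \<in> {x k} \<inter> {..<m k}}"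
      by (auto simp: vgroup_def)
    then show ?thesis
      unfolding sets_vmeasure_eq by (intro sigma_sets.Basic) blast
  qed
  show ?thesis
  proof (induction n)
    case 0
    show ?case using sets.top[of "vmeasure m"] by (simp add: vinterval_def)
  next
    case (Suc n)
    have "vinterval m (Suc n) x = vinterval m n x \<inter> {y \<in> vgroup m. y n = x n}"
      by (auto simp: vinterval_def less_Suc_eq)
    with Suc * show ?case by auto
  qed
qed

lemma sets_vmeasure:
  "sets (vmeasure m) = sigma_sets (vgroup m) {U. openin (vtopology m) U}"
proof (rule antisym)
  show "sets (vmeasure m) \<subseteq> sigma_sets (vgroup m) {U. openin (vtopology m) U}"
    unfolding sets_vmeasure_eq
  proof (rule sigma_sets_mono', safe)
    fix i A assume A: "A \<subseteq> {..<m i}"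
    let ?X = "\<lambda>k. if k = i then A else {..<m k}"
    have eq: "{y \<in> vgroup m. y i \<in> A} = Pi\<^sub>E UNIV ?X"
      using A by (force simp: vgroup_def PiE_def Pi_def split: if_splits)
    have "finite {k. ?X k \<noteq> {..<m k}}"
      by (rule finite_subset[of _ "{i}"]) auto
    then show "openin (vtopology m) {y \<in> vgroup m. y i \<in> A}"
      unfolding eq vtopology_def using A by (subst openin_PiE_gen) auto
  qed
next
  have "U \<in> sets (vmeasure m)" if U: "openin (vtopology m) U" for U
  proof -
    define C where "C = {vinterval m n x | n x. vinterval m n x \<subseteq> U}"
    have "C \<subseteq> (\<lambda>(n, l). {y \<in> vgroup m. \<forall>k<n. y k = l ! k}) ` (UNIV \<times> UNIV)"
    proof
      fix B assume "B \<in> C"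
      then obtain n x where "B = vinterval m n x" by (auto simp: C_def)
      then have "B = {y \<in> vgroup m. \<forall>k<n. y k = map x [0..<n] ! k}"
        by (auto simp: vinterval_def)
      then show "B \<in> (\<lambda>(n, l). {y \<in> vgroup m. \<forall>k<n. y k = l ! k}) ` (UNIV \<times> UNIV)"
        by (intro image_eqI[where x = "(n, map x [0..<n])"]) auto
    qed
    then have "countable C"
      by (rule countable_subset) auto
    moreover have "C \<subseteq> sets (vmeasure m)"
      by (auto simp: C_def vinterval_sets)
    moreover have "U = \<Union>C"
    proof
      show "U \<subseteq> \<Union>C"
      proof
        fix x assume x: "x \<in> U"
        obtain X where X: "finite {i. X i \<noteq> {..<m i}}" "x \<in> Pi\<^sub>E UNIV X" "Pi\<^sub>E UNIV X \<subseteq> U"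
          using U x unfolding vtopology_def openin_product_topology_alt by auto
        obtain n where n: "{i. X i \<noteq> {..<m i}} \<subseteq> {..<n}"
          using finite_nat_iff_bounded[THEN iffD1, OF X(1)] by auto
        have "vinterval m n x \<subseteq> Pi\<^sub>E UNIV X"
        proof
          fix y assume y: "y \<in> vinterval m n x"
          have "y k \<in> X k" for k
            using y n X(2) by (cases "k < n") (auto simp: vinterval_def vgroup_def PiE_def Pi_def)
          then show "y \<in> Pi\<^sub>E UNIV X" by auto
        qed
        then have "vinterval m n x \<in> C" using X(3) unfolding C_def by blast
        moreover have "x \<in> vinterval m n x"
          using openin_subset[OF U] x by (auto simp: vinterval_def)
        ultimately show "x \<in> \<Union>C" by blast
      qed
    qed (auto simp: C_def)
    ultimately show ?thesis by (metis sets.countable_Union)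
  qed
  then show "sigma_sets (vgroup m) {U. openin (vtopology m) U} \<subseteq> sets (vmeasure m)"
    using sets.sigma_sets_subset[of "{U. openin (vtopology m) U}" "vmeasure m"] by auto
qed

lemma vmeasure_translation_invariant:
  assumes m: "\<And>k. 2 \<le> m k" and a: "a \<in> vgroup m"
  shows "distr (vmeasure m) (vmeasure m) (\<lambda>x k. (x k + a k) mod m k) = vmeasure m"
proof -
  let ?M = "\<lambda>k. uniform_count_measure {..<m k}"
  let ?t = "\<lambda>k z. (z + a k) mod m k"
  interpret product_prob_space ?M UNIV
    by (intro product_prob_spaceI prob_space_uniform_lessThan m)
  have pos: "0 < m k" for k using m[of k] by simp
  have meas: "(\<lambda>x k. ?t k (x k)) \<in> PiM UNIV ?M \<rightarrow>\<^sub>M PiM UNIV ?M"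
  proof (rule measurable_PiM_single')
    fix i :: nat
    have "?t i \<in> ?M i \<rightarrow>\<^sub>M ?M i"
      by (auto simp: measurable_def space_uniform_count_measure sets_uniform_count_measure pos)
    then show "(\<lambda>x. ?t i (x i)) \<in> PiM UNIV ?M \<rightarrow>\<^sub>M ?M i"
      by (rule measurable_compose[rotated]) simp
  qed (auto simp: space_PiM space_uniform_count_measure pos)
  have inj: "inj_on (?t k) {..<m k}" for k
  proof (rule inj_onI)
    fix y z assume yz: "y \<in> {..<m k}" "z \<in> {..<m k}" "?t k y = ?t k z"
    then have "[y + a k = z + a k] (mod m k)" by (simp add: cong_def)
    then have "[y = z] (mod m k)" by (simp only: cong_add_rcancel_nat)
    with yz show "y = z" by (simp add: cong_def)
  qed
  have bij: "bij_betw (?t k) {..<m k} {..<m k}" for k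
    unfolding bij_betw_def using pos[of k]
    by (intro conjI inj endo_inj_surj[OF _ _ inj]) auto
  have card: "emeasure (?M k) ({z \<in> {..<m k}. ?t k z \<in> A}) = emeasure (?M k) A"
    if A: "A \<subseteq> {..<m k}" for k A
  proof -
    have "?t k ` {z \<in> {..<m k}. ?t k z \<in> A} = A"
      using A bij[of k] by (auto simp: bij_betw_def)
    then have "card A = card {z \<in> {..<m k}. ?t k z \<in> A}"
      by (metis (no_types, lifting) card_image inj inj_on_subset mem_Collect_eq subsetI)
    then show ?thesis using A
      by (auto simp: emeasure_uniform_count_measure_if)
  qed
  have "distr (PiM UNIV ?M) (PiM UNIV ?M) (\<lambda>x k. ?t k (x k)) = PiM UNIV ?M"
  proof (rule PiM_eq)
    show "sets (distr (PiM UNIV ?M) (PiM UNIV ?M) (\<lambda>x k. ?t k (x k))) = sets (PiM UNIV ?M)"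
      by simp
    fix J F assume J: "finite J" "J \<subseteq> UNIV" "\<And>j. j \<in> J \<Longrightarrow> F j \<in> sets (?M j)"
    let ?F = "\<lambda>j. {z \<in> {..<m j}. ?t j z \<in> F j}"
    have F: "F j \<subseteq> {..<m j}" if "j \<in> J" for j
      using J(3)[OF that] by (simp add: sets_uniform_count_measure)
    have "emeasure (distr (PiM UNIV ?M) (PiM UNIV ?M) (\<lambda>x k. ?t k (x k)))
             (prod_emb UNIV ?M J (Pi\<^sub>E J F))
        = emeasure (PiM UNIV ?M) ((\<lambda>x k. ?t k (x k)) -` prod_emb UNIV ?M J (Pi\<^sub>E J F)
             \<inter> space (PiM UNIV ?M))"
      using J by (intro emeasure_distr meas sets_PiM_I) auto
    also have "(\<lambda>x k. ?t k (x k)) -` prod_emb UNIV ?M J (Pi\<^sub>E J F) \<inter> space (PiM UNIV ?M)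
        = prod_emb UNIV ?M J (Pi\<^sub>E J ?F)"
      by (auto simp: prod_emb_def space_PiM space_uniform_count_measure PiE_iff pos)
    also have "emeasure (PiM UNIV ?M) (prod_emb UNIV ?M J (Pi\<^sub>E J ?F))
        = (\<Prod>j\<in>J. emeasure (?M j) (?F j))"
      using J by (intro emeasure_PiM_emb) (auto simp: sets_uniform_count_measure)
    also have "\<dots> = (\<Prod>j\<in>J. emeasure (?M j) (F j))"
      using F by (intro prod.cong refl card)
    finally show "emeasure (distr (PiM UNIV ?M) (PiM UNIV ?M) (\<lambda>x k. ?t k (x k)))
             (prod_emb UNIV ?M J (Pi\<^sub>E J F)) = (\<Prod>j\<in>J. emeasure (?M j) (F j))" .
  qed
  then show ?thesis by (simp add: vmeasure_def)
qed


section \<open>The Vilenkin system and Fourier series of functions\<close>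

primrec vM :: "(nat \<Rightarrow> nat) \<Rightarrow> nat \<Rightarrow> nat" where
  "vM m 0 = 1"
| "vM m (Suc k) = m k * vM m k"

definition vdigit :: "(nat \<Rightarrow> nat) \<Rightarrow> nat \<Rightarrow> nat \<Rightarrow> nat" where
  "vdigit m n j = (n div vM m j) mod m j"

lemma sum_vdigit_lessThan: "(\<Sum>j<N. vdigit m n j * vM m j) = n mod vM m N"
proof (induction N)
  case (Suc N)
  have "n mod (vM m N * m N) = vM m N * (n div vM m N mod m N) + n mod vM m N"
    by (rule mod_mult2_eq)
  with Suc show ?case by (simp add: vdigit_def mult.commute)
qed simp

lemma less_vM:
  assumes "\<And>k. 2 \<le> m k"
  shows "n < vM m n"
proof (induction n)
  case (Suc n)
  have "2 * vM m n \<le> m n * vM m n" using assms by (intro mult_right_mono) auto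
  with Suc show ?case unfolding vM.simps by linarith
qed simp

lemma vdigit_expansion:
  assumes "\<And>k. 2 \<le> m k"
  shows "finite {j. vdigit m n j \<noteq> 0}"
    and "vdigit m n j < m j"
    and "n = (\<Sum>j | vdigit m n j \<noteq> 0. vdigit m n j * vM m j)"
proof -
  have z: "vdigit m n j = 0" if "n \<le> j" for j
    using less_vM[of m j] assms that by (simp add: vdigit_def)
  then have sub: "{j. vdigit m n j \<noteq> 0} \<subseteq> {..<n}" using not_less by blast
  then show "finite {j. vdigit m n j \<noteq> 0}" using finite_subset by blast
  show "vdigit m n j < m j" using assms[of j] by (simp add: vdigit_def)
  have "n = (\<Sum>j<n. vdigit m n j * vM m j)"
    using less_vM[of m n] assms by (simp add: sum_vdigit_lessThan)
  also have "\<dots> = (\<Sum>j | vdigit m n j \<noteq> 0. vdigit m n j * vM m j)"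
    using sub by (intro sum.mono_neutral_right) auto
  finally show "n = (\<Sum>j | vdigit m n j \<noteq> 0. vdigit m n j * vM m j)" .
qed

definition vrademacher :: "(nat \<Rightarrow> nat) \<Rightarrow> nat \<Rightarrow> (nat \<Rightarrow> nat) \<Rightarrow> complex" where
  "vrademacher m k x = exp (2 * of_real pi * \<i> * of_nat (x k) / of_nat (m k))"

text \<open>Only the finitely many factors with nonzero digit contribute to the product over all \<open>k\<close>.\<close>

definition vilenkin :: "(nat \<Rightarrow> nat) \<Rightarrow> nat \<Rightarrow> (nat \<Rightarrow> nat) \<Rightarrow> complex" where
  "vilenkin m n x = (\<Prod>k | vdigit m n k \<noteq> 0. vrademacher m k x ^ vdigit m n k)"

definition fourier_coeff :: "(nat \<Rightarrow> nat) \<Rightarrow> ((nat \<Rightarrow> nat) \<Rightarrow> complex) \<Rightarrow> nat \<Rightarrow> complex" where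
  "fourier_coeff m g k = (\<integral>x. g x * cnj (vilenkin m k x) \<partial>vmeasure m)"

definition fourier_sum ::
    "(nat \<Rightarrow> nat) \<Rightarrow> nat \<Rightarrow> ((nat \<Rightarrow> nat) \<Rightarrow> complex) \<Rightarrow> (nat \<Rightarrow> nat) \<Rightarrow> complex" where
  "fourier_sum m n g x = (\<Sum>k<n. fourier_coeff m g k * vilenkin m k x)"


section \<open>Martingales\<close>

type_synonym vprocess = "nat \<Rightarrow> (nat \<Rightarrow> nat) \<Rightarrow> complex"

text \<open>
  Nonempty sets in the filtration have positive measure, so the consistency condition
  holds at every point as soon as it holds almost everywhere.
\<close>

definition vmartingale :: "(nat \<Rightarrow> nat) \<Rightarrow> vprocess \<Rightarrow> bool" where
  "vmartingale m f \<longleftrightarrow>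
     (\<forall>n. integrable (vmeasure m) (f n)) \<and>
     (\<forall>n. f n \<in> borel_measurable (vfiltration m n)) \<and>
     (\<forall>n k. n \<le> k \<longrightarrow> (\<forall>x\<in>vgroup m. fourier_sum m (vM m n) (f k) x = f n x))"

definition mart_coeff :: "(nat \<Rightarrow> nat) \<Rightarrow> vprocess \<Rightarrow> nat \<Rightarrow> complex" where
  "mart_coeff m f i = lim (\<lambda>k. \<integral>x. f k x * cnj (vilenkin m i x) \<partial>vmeasure m)"

definition mart_sum :: "(nat \<Rightarrow> nat) \<Rightarrow> nat \<Rightarrow> vprocess \<Rightarrow> (nat \<Rightarrow> nat) \<Rightarrow> complex" where
  "mart_sum m n f x = (\<Sum>k<n. mart_coeff m f k * vilenkin m k x)"

definition fejer_mean :: "(nat \<Rightarrow> nat) \<Rightarrow> nat \<Rightarrow> vprocess \<Rightarrow> (nat \<Rightarrow> nat) \<Rightarrow> complex" where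
  "fejer_mean m n f x = (\<Sum>k=1..n. mart_sum m k f x) / of_nat n"

definition mart_of :: "(nat \<Rightarrow> nat) \<Rightarrow> ((nat \<Rightarrow> nat) \<Rightarrow> complex) \<Rightarrow> vprocess" where
  "mart_of m g = (\<lambda>k. fourier_sum m (vM m k) g)"

definition mart_diff :: "vprocess \<Rightarrow> vprocess \<Rightarrow> vprocess" where
  "mart_diff f g = (\<lambda>k x. f k x - g k x)"


section \<open>Norms\<close>

text \<open>\<open>ennreal\<close> has no real powers in the library; this one is meant for \<open>p > 0\<close>.\<close>

definition ennreal_powr :: "ennreal \<Rightarrow> real \<Rightarrow> ennreal" where
  "ennreal_powr a p = (if a = \<infinity> then \<infinity> else ennreal (enn2real a powr p))"

definition Lp_norm :: "(nat \<Rightarrow> nat) \<Rightarrow> real \<Rightarrow> ((nat \<Rightarrow> nat) \<Rightarrow> ennreal) \<Rightarrow> ennreal" where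
  "Lp_norm m p g = ennreal_powr (\<integral>\<^sup>+x. ennreal_powr (g x) p \<partial>vmeasure m) (1 / p)"

definition mart_Lp_norm :: "(nat \<Rightarrow> nat) \<Rightarrow> real \<Rightarrow> vprocess \<Rightarrow> ennreal" where
  "mart_Lp_norm m p f = (SUP n. Lp_norm m p (\<lambda>x. ennreal (norm (f n x))))"

definition mart_max :: "vprocess \<Rightarrow> (nat \<Rightarrow> nat) \<Rightarrow> ennreal" where
  "mart_max f x = (SUP n. ennreal (norm (f n x)))"

definition Hp_norm :: "(nat \<Rightarrow> nat) \<Rightarrow> real \<Rightarrow> vprocess \<Rightarrow> ennreal" where
  "Hp_norm m p f = Lp_norm m p (mart_max f)"

definition Hp_space :: "(nat \<Rightarrow> nat) \<Rightarrow> real \<Rightarrow> vprocess set" where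
  "Hp_space m p = {f. vmartingale m f \<and> Hp_norm m p f < \<infinity>}"

text \<open>\<open>Hp_modulus m p n f\<close> is the modulus of continuity of \<open>f\<close> in \<open>H\<^sub>p\<close> at \<open>1 / vM m n\<close>.\<close>

definition Hp_modulus :: "(nat \<Rightarrow> nat) \<Rightarrow> real \<Rightarrow> nat \<Rightarrow> vprocess \<Rightarrow> ennreal" where
  "Hp_modulus m p n f = Hp_norm m p (mart_diff f (mart_of m (mart_sum m (vM m n) f)))"

end

theory Submission
  imports Defs
begin

text \<open>
  Both parts reduce to single frequency blocks \<open>[M\<^sub>N, M\<^bsub>N+1\<^esub>)\<close>. A polynomial \<open>g\<close> with spectrum below \<open>M\<^sub>N\<close>
  is a sum of \<open>M\<^sub>N\<close> point masses, so the subadditivity of \<open>\<integral>\<bar>\<cdot>\<bar>\<^bsup>1/2\<^esup>\<close> bounds its Fejer mean of order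
  \<open>n \<le> M\<^sub>N\<close> by \<open>(M\<^sub>N / n)\<^bsup>1/2\<^esup> \<integral>\<bar>n K\<^sub>n\<bar>\<^bsup>1/2\<^esup> \<integral>\<bar>g\<bar>\<^bsup>1/2\<^esup>\<close>, and splitting off the leading digit of \<open>n\<close> shows
  \<open>\<integral>\<bar>n K\<^sub>n\<bar>\<^bsup>1/2\<^esup> = O(N)\<close>. For \<open>M\<^sub>N \<le> n < M\<^bsub>N+1\<^esub>\<close> the error \<open>\<sigma>\<^sub>n f - f\<close> consists of the tail of \<open>f\<close>, the
  Fejer mean of the block \<open>N\<close>, whose size is \<open>N\<close> times the square root of the modulus of continuity, and
  earlier blocks \<open>i < N\<close>, damped by \<open>(M\<^bsub>i+1\<^esub> / n)\<^bsup>1/2\<^esup>\<close>.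

  The bound \<open>O(N)\<close> is attained for \<open>n = M\<^sub>0 + M\<^sub>2 + M\<^sub>4 + \<dots>\<close>: where the first nonzero coordinates are two
  consecutive ones at the positions \<open>2 i\<close> and \<open>2 i + 1\<close>, one has \<open>\<bar>n K\<^sub>n\<bar> \<ge> M\<^bsub>2i\<^esub>\<^sup>2 / 2\<close>, and each \<open>i\<close> contributes
  a constant to the integral. The counterexample has on the blocks \<open>N = 2\<^sup>k\<close> the coefficients \<open>M\<^sub>N / N\<^sup>2\<close>.
\<close>

section \<open>Square roots, partial sums and geometric convolutions\<close>

lemma sqrt_norm_add_le: "sqrt (norm (a + b)) \<le> sqrt (norm a) + sqrt (norm (b :: 'a :: real_normed_vector))"
  by (metis norm_triangle_ineq norm_ge_zero order_trans real_sqrt_le_mono sqrt_add_le_add_sqrt)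

lemma sqrt_norm_sum_le:
  "sqrt (norm (\<Sum>i\<in>A. f i)) \<le> (\<Sum>i\<in>A. sqrt (norm (f i :: 'a :: real_normed_vector)))"
proof (cases "finite A")
  case True
  then show ?thesis
  proof induction
    case (insert x A)
    then show ?case using sqrt_norm_add_le[of "f x" "sum f A"] by simp
  qed simp
qed simp

text \<open>The term \<open>f j\<close> occurs in the inner sums with \<open>j < k \<le> n\<close>,
  hence \<open>n - j\<close> times. Truncated subtraction gives weight 0 from \<open>j = n\<close>
  on, so the range of such sums can later be enlarged.\<close>

lemma sum_partial_sums:
  "(\<Sum>k=1..n. \<Sum>j<k. f j) = (\<Sum>j<n. of_nat (n - j) * (f j :: 'a :: comm_ring_1))"
proof (induction n)
  case (Suc n)
  have "(\<Sum>j<Suc n. of_nat (Suc n - j) * f j) = (\<Sum>j<Suc n. of_nat (n - j) * f j + f j)"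
    by (intro sum.cong) (auto simp: Suc_diff_le distrib_right)
  then show ?case
    using Suc by (simp add: sum.distrib)
qed simp

text \<open>Root and square form a Galois connection, infinity included.\<close>

lemma ennreal_powr_half_le_iff: "ennreal_powr a (1/2) \<le> s \<longleftrightarrow> a \<le> s * s"
proof (cases a)
  case (real r)
  show ?thesis
  proof (cases s)
    case (real t)
    have "sqrt r \<le> t \<longleftrightarrow> r \<le> t * t"
      using \<open>0 \<le> t\<close> by (metis abs_of_nonneg real_sqrt_abs2 real_sqrt_le_iff)
    with real \<open>a = ennreal r\<close> \<open>0 \<le> r\<close> show ?thesis
      by (simp add: ennreal_powr_def powr_half_sqrt ennreal_mult[symmetric])
  next
    case top
    then show ?thesis by (simp add: ennreal_top_mult)
  qed
next
  case top
  then show ?thesis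
    by (cases s) (auto simp: ennreal_powr_def ennreal_mult[symmetric] ennreal_top_mult top_unique)
qed

lemma ennreal_powr_half: "0 \<le> r \<Longrightarrow> ennreal_powr (ennreal r) (1/2) = ennreal (sqrt r)"
  by (simp add: ennreal_powr_def powr_half_sqrt)

lemma ennreal_powr_two: "ennreal_powr a 2 = a * a"
  by (cases a) (auto simp: ennreal_powr_def powr_numeral power2_eq_square ennreal_mult
      ennreal_top_mult)

text \<open>A lower adjoint preserves suprema. This moves the root inside the maximal
  function.\<close>

lemma ennreal_powr_half_SUP: "ennreal_powr (SUP k. u k) (1/2) = (SUP k. ennreal_powr (u k) (1/2))"
proof (rule antisym)
  let ?s = "SUP k. ennreal_powr (u k) (1/2)"
  have "u k \<le> ?s * ?s" for k
    unfolding ennreal_powr_half_le_iff[symmetric] by (rule SUP_upper) simp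
  then show "ennreal_powr (SUP k. u k) (1/2) \<le> ?s"
    unfolding ennreal_powr_half_le_iff by (rule SUP_least)
next
  let ?s = "ennreal_powr (SUP k. u k) (1/2)"
  have "(SUP k. u k) \<le> ?s * ?s"
    unfolding ennreal_powr_half_le_iff[symmetric] by (rule order_refl)
  then have "u k \<le> ?s * ?s" for k
    by (rule order_trans[OF SUP_upper, rotated]) simp
  then show "(SUP k. ennreal_powr (u k) (1/2)) \<le> ?s"
    by (intro SUP_least) (simp only: ennreal_powr_half_le_iff)
qed

lemma ennreal_powr_half_mult_self: "ennreal_powr (a * a) (1/2) = a"
  by (cases a) (auto simp: ennreal_powr_half ennreal_mult[symmetric] ennreal_powr_def[of top]
      ennreal_top_mult)

lemma ennreal_mult_self_le_iff: "a * a \<le> b * b \<longleftrightarrow> a \<le> (b :: ennreal)"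
  by (metis ennreal_powr_half_le_iff ennreal_powr_half_mult_self)

text \<open>In terms of the lag \<open>k = N - i\<close>, each term \<open>q ^ k * b (N - k)\<close>
  tends to 0 and is dominated by \<open>C * q ^ k\<close>, so Tannery's theorem applies.\<close>

lemma tendsto_geometric_convolution_0:
  fixes b :: "nat \<Rightarrow> real"
  assumes b: "b \<longlonglongrightarrow> 0" and q: "0 \<le> q" "q < 1"
  shows "(\<lambda>N. \<Sum>i\<le>N. q ^ (N - i) * b i) \<longlonglongrightarrow> 0"
proof -
  \<comment> \<open>The value 0 for \<open>k > N\<close> turns the finite sum into a series over all
    \<open>k\<close>.\<close>
  define a where "a = (\<lambda>k N. if k \<le> N then q ^ k * b (N - k) else 0)"
  obtain C where C: "\<And>n. norm (b n) \<le> C"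
    using b[THEN convergentI, THEN convergent_imp_Bseq] by (auto simp: Bseq_def)
  have "((\<lambda>N. \<Sum>k. a k N) \<longlongrightarrow> (\<Sum>k. (0::real))) sequentially"
  proof (intro tannerys_theorem[THEN conjunct2, THEN conjunct2])
    show "(\<lambda>N. a k N) \<longlonglongrightarrow> 0" for k
    proof (rule Lim_transform_eventually)
      have "(\<lambda>N. b (N - k)) \<longlonglongrightarrow> 0"
        by (rule filterlim_compose[OF b]) (rule filterlim_minus_const_nat_at_top)
      then show "(\<lambda>N. q ^ k * b (N - k)) \<longlonglongrightarrow> 0"
        by (rule tendsto_mult_right_zero)
      show "\<forall>\<^sub>F N in sequentially. q ^ k * b (N - k) = a k N"
        using eventually_ge_at_top[of k] by eventually_elim (simp add: a_def)
    qed
    have "norm (a k N) \<le> C * q ^ k" for k N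
      using C[of "N - k"] q norm_ge_zero[of "b 0"] C[of 0]
      by (auto simp: a_def abs_mult mult.commute[of C] intro: mult_left_mono)
    then show "\<forall>\<^sub>F (k, N) in sequentially \<times>\<^sub>F sequentially. norm (a k N) \<le> C * q ^ k"
      by (intro always_eventually) auto
    show "summable (\<lambda>k. C * q ^ k)"
      using q by (intro summable_mult summable_geometric) simp
  qed simp
  moreover have "(\<Sum>k. a k N) = (\<Sum>i\<le>N. q ^ (N - i) * b i)" for N
  proof -
    have "(\<Sum>k. a k N) = (\<Sum>k\<le>N. a k N)"
      by (rule suminf_finite) (auto simp: a_def)
    also have "\<dots> = (\<Sum>i\<le>N. a (N - i) N)"
      by (rule sum.nat_diff_reindex[symmetric, of "\<lambda>k. a k N" "Suc N", simplified lessThan_Suc_atMost, simplified])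
    finally show ?thesis by (simp add: a_def)
  qed
  ultimately show ?thesis by simp
qed

locale vilenkin_system =
  fixes m :: "nat \<Rightarrow> nat" and B :: nat
  assumes two_le: "2 \<le> m k" and le_B: "m k \<le> B"
begin

section \<open>Cylindrical functions on the Vilenkin group\<close>

abbreviation "G \<equiv> vgroup m"
abbreviation "M \<equiv> vM m"
abbreviation "\<mu> \<equiv> vmeasure m"
abbreviation "\<psi> \<equiv> vilenkin m"
abbreviation "rad \<equiv> vrademacher m"

sublocale prob_space \<mu>
  by (rule prob_space_vmeasure) (rule two_le)

section \<open>The numbers \<open>M n\<close> and digit expansions\<close>

lemma m_pos: "0 < m k"
  using two_le[of k] by simp

lemma B_ge: "2 \<le> B"
  using two_le[of 0] le_B[of 0] by simp

lemma M_pos: "0 < M n"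
  by (induction n) (auto simp: m_pos)

lemma M_double: "2 * M n \<le> M (Suc n)"
  using two_le by (simp add: mult_right_mono)

lemma M_mono: "i \<le> j \<Longrightarrow> M i \<le> M j"
proof (induction j rule: dec_induct)
  case (step n)
  then show ?case using M_double[of n] by linarith
qed simp

lemma M_strict: "i < j \<Longrightarrow> M i < M j"
  using M_mono[of "Suc i" j] M_double[of i] M_pos[of i] by linarith

lemma M_dvd: "k < n \<Longrightarrow> M (Suc k) dvd M n"
proof (induction n)
  case (Suc n)
  then show ?case by (cases "k = n") (auto intro: dvd_mult)
qed simp

lemma less_M: "n < M n"
  by (rule less_vM) (rule two_le)

lemma vdigit_less: "vdigit m n k < m k"
  by (simp add: vdigit_def m_pos)

lemma vdigit_in_G: "vdigit m n \<in> G"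
  by (simp add: vgroup_def vdigit_less)

lemma vdigit_eq_0: "n < M k \<Longrightarrow> vdigit m n k = 0"
  by (simp add: vdigit_def)

lemma vdigit_eq_0_above: "n < M k \<Longrightarrow> k \<le> l \<Longrightarrow> vdigit m n l = 0"
  using M_mono[of k l] by (intro vdigit_eq_0) simp

text \<open>\<open>M A\<close> is a multiple of \<open>M (Suc k)\<close>, so adding
  \<open>a * M A\<close> changes the quotient by \<open>M k\<close> only by a multiple of
  \<open>m k\<close>.\<close>

lemma vdigit_low: "k < A \<Longrightarrow> vdigit m (a * M A + r) k = vdigit m r k"
proof -
  assume "k < A"
  then obtain c where c: "M A = M k * (m k * c)"
    using M_dvd[of k A] by (auto simp: dvd_def mult_ac)
  have "(r + (a * c * m k) * M k) div M k = a * c * m k + r div M k"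
    using M_pos[of k] by (intro div_mult_self1) simp
  then have "(a * M A + r) div M k = a * c * m k + r div M k"
    by (simp add: c mult_ac add.commute)
  then show ?thesis by (simp add: vdigit_def)
qed

lemma vdigit_top: "r < M A \<Longrightarrow> a < m A \<Longrightarrow> vdigit m (a * M A + r) A = a"
  by (simp add: vdigit_def)

lemma block_less: "r < M A \<Longrightarrow> a < m A \<Longrightarrow> a * M A + r < M (Suc A)"
proof -
  assume "r < M A" "a < m A"
  then have "a * M A + r < Suc a * M A" by simp
  also have "\<dots> \<le> m A * M A" using \<open>a < m A\<close> by (intro mult_right_mono) auto
  finally show ?thesis by simp
qed

lemma vdigit_inj:
  assumes "i < M n" "j < M n" "\<And>k. k < n \<Longrightarrow> vdigit m i k = vdigit m j k"
  shows "i = j"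
proof -
  have "(\<Sum>k<n. vdigit m i k * M k) = (\<Sum>k<n. vdigit m j k * M k)"
    using assms(3) by (intro sum.cong) auto
  then show ?thesis
    using assms(1,2) by (simp add: sum_vdigit_lessThan)
qed

text \<open>Digit sequences are themselves points of the group. Those of the numbers below
  \<open>M n\<close> represent all intervals of level \<open>n\<close> and serve as sample points
  for integration.\<close>

lemma ex_vdigit:
  assumes "x \<in> G"
  shows "\<exists>j<M n. \<forall>k<n. vdigit m j k = x k"
proof (induction n)
  case (Suc n)
  then obtain j where j: "j < M n" "\<And>k. k < n \<Longrightarrow> vdigit m j k = x k" by blast
  have "x n < m n" using assms by (simp add: vgroup_def)
  with j show ?case
    by (intro exI[of _ "x n * M n + j"]) (auto simp: block_less less_Suc_eq vdigit_low vdigit_top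
        simp del: vM.simps)
qed simp

lemma measure_vinterval:
  assumes "x \<in> G"
  shows "measure \<mu> (vinterval m n x) = 1 / real (M n)"
proof -
  let ?U = "\<lambda>k. uniform_count_measure {..<m k}"
  interpret P: product_prob_space ?U UNIV
    by (intro product_prob_spaceI prob_space_uniform_lessThan two_le)
  have x: "x k < m k" for k using assms by (simp add: vgroup_def)
  have "vinterval m n x = prod_emb UNIV ?U {..<n} (Pi\<^sub>E {..<n} (\<lambda>k. {x k}))"
    by (force simp: vinterval_def prod_emb_def vgroup_eq_PiE space_uniform_count_measure PiE_iff)
  then have "measure \<mu> (vinterval m n x) = (\<Prod>k<n. measure (?U k) {x k})"
    unfolding vmeasure_def using x
    by (simp only: P.measure_PiM_emb) (subst P.measure_PiM_emb, auto simp: sets_uniform_count_measure)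
  also have "\<dots> = (\<Prod>k<n. 1 / real (m k))"
    using x by (intro prod.cong) (auto simp: measure_uniform_count_measure)
  also have "\<dots> = 1 / real (M n)"
    by (induction n) auto
  finally show ?thesis .
qed

text \<open>Constancy on the intervals of level \<open>n\<close> is a pointwise substitute for
  measurability with respect to the \<open>n\<close>-th sigma-algebra. It is preserved by sums,
  products and arbitrary compositions.\<close>

definition cylindrical :: "nat \<Rightarrow> ((nat \<Rightarrow> nat) \<Rightarrow> 'a) \<Rightarrow> bool" where
  "cylindrical n h \<longleftrightarrow> (\<forall>x\<in>G. \<forall>y\<in>G. (\<forall>k<n. x k = y k) \<longrightarrow> h x = h y)"

lemma cylindricalD: "cylindrical n h \<Longrightarrow> x \<in> G \<Longrightarrow> y \<in> G \<Longrightarrow> (\<And>k. k < n \<Longrightarrow> x k = y k) \<Longrightarrow> h x = h y"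
  unfolding cylindrical_def by blast

lemma cylindricalI:
  "(\<And>x y. x \<in> G \<Longrightarrow> y \<in> G \<Longrightarrow> (\<And>k. k < n \<Longrightarrow> x k = y k) \<Longrightarrow> h x = h y) \<Longrightarrow> cylindrical n h"
  unfolding cylindrical_def by blast

lemma cylindrical_mono:
  assumes "cylindrical n h" "n \<le> N"
  shows "cylindrical N h"
proof (rule cylindricalI)
  fix x y assume "x \<in> G" "y \<in> G" and eq: "\<And>k. k < N \<Longrightarrow> x k = y k"
  then show "h x = h y"
    using assms(2) by (intro cylindricalD[OF assms(1)] eq) (auto intro: less_le_trans)
qed

lemma cylindrical_comp:
  assumes "cylindrical n f"
  shows "cylindrical n (\<lambda>x. F (f x))"
proof (rule cylindricalI)
  fix x y assume "x \<in> G" "y \<in> G" "\<And>k. k < n \<Longrightarrow> x k = y k"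
  then have "f x = f y" by (rule cylindricalD[OF assms])
  then show "F (f x) = F (f y)" by (rule arg_cong)
qed

lemma cylindrical_comp2:
  assumes "cylindrical n f" "cylindrical n g"
  shows "cylindrical n (\<lambda>x. F (f x) (g x))"
proof (rule cylindricalI)
  fix x y assume *: "x \<in> G" "y \<in> G" "\<And>k. k < n \<Longrightarrow> x k = y k"
  have "f x = f y" "g x = g y"
    using cylindricalD[OF assms(1) *] cylindricalD[OF assms(2) *] by auto
  then show "F (f x) (g x) = F (f y) (g y)" by (rule arg_cong2)
qed

lemma cylindrical_sum:
  assumes "\<And>i. i \<in> I \<Longrightarrow> cylindrical n (f i)"
  shows "cylindrical n (\<lambda>x. \<Sum>i\<in>I. f i x)"
  by (rule cylindricalI) (rule sum.cong[OF refl], rule cylindricalD[OF assms])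

lemma cylindrical_prod:
  assumes "\<And>i. i \<in> I \<Longrightarrow> cylindrical n (f i)"
  shows "cylindrical n (\<lambda>x. \<Prod>i\<in>I. f i x)"
  by (rule cylindricalI) (rule prod.cong[OF refl], rule cylindricalD[OF assms])

lemma cylindrical_coord: "k < n \<Longrightarrow> cylindrical n (\<lambda>x. x k)"
  by (simp add: cylindrical_def)

text \<open>On \<open>G\<close> the function is a step function: on each of the \<open>M n\<close>
  intervals, all of measure \<open>1 / M n\<close>, it has its value at the sample point.\<close>

lemma has_integral_cylindrical:
  fixes h :: "(nat \<Rightarrow> nat) \<Rightarrow> 'a :: {banach, second_countable_topology}"
  assumes h: "cylindrical n h"
  shows "has_bochner_integral \<mu> h ((\<Sum>j<M n. h (vdigit m j)) /\<^sub>R real (M n))"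
proof -
  have "has_bochner_integral \<mu>
      (\<lambda>x. \<Sum>j<M n. indicator (vinterval m n (vdigit m j)) x *\<^sub>R h (vdigit m j))
      (\<Sum>j<M n. measure \<mu> (vinterval m n (vdigit m j)) *\<^sub>R h (vdigit m j))"
    by (intro has_bochner_integral_sum has_bochner_integral_indicator vinterval_sets)
      (simp add: emeasure_eq_measure)
  also have "(\<Sum>j<M n. measure \<mu> (vinterval m n (vdigit m j)) *\<^sub>R h (vdigit m j)) =
      (\<Sum>j<M n. h (vdigit m j)) /\<^sub>R real (M n)"
    by (simp add: measure_vinterval vdigit_in_G scaleR_sum_right divide_inverse)
  finally have int: "has_bochner_integral \<mu>
      (\<lambda>x. \<Sum>j<M n. indicator (vinterval m n (vdigit m j)) x *\<^sub>R h (vdigit m j))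
      ((\<Sum>j<M n. h (vdigit m j)) /\<^sub>R real (M n))" .
  have eq: "(\<Sum>j<M n. indicator (vinterval m n (vdigit m j)) x *\<^sub>R h (vdigit m j)) = h x"
    if "x \<in> space \<mu>" for x
  proof -
    have x: "x \<in> G" using that by simp
    then obtain j where j: "j < M n" "\<And>k. k < n \<Longrightarrow> vdigit m j k = x k"
      using ex_vdigit by blast
    have *: "indicator (vinterval m n (vdigit m i)) x = (if i = j then 1 else 0 :: real)"
      if i: "i < M n" for i
    proof (cases "i = j")
      case False
      then obtain k where "k < n" "vdigit m i k \<noteq> vdigit m j k"
        using vdigit_inj[OF i j(1)] by blast
      then have "x \<notin> vinterval m n (vdigit m i)"
        using j(2) by (auto simp: vinterval_def)
      with False show ?thesis by simp
    qed (use x j in \<open>simp add: vinterval_def\<close>)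
    have "(\<Sum>i<M n. indicator (vinterval m n (vdigit m i)) x *\<^sub>R h (vdigit m i))
        = (\<Sum>i<M n. if i = j then h (vdigit m j) else 0)"
      by (intro sum.cong) (auto simp: *)
    also have "\<dots> = h (vdigit m j)"
      using j(1) by simp
    also have "\<dots> = h x"
      by (rule cylindricalD[OF h vdigit_in_G x j(2)])
    finally show ?thesis .
  qed
  show ?thesis
    using int by (subst has_bochner_integral_cong[OF refl eq[symmetric] refl])
qed

lemma integral_cylindrical:
  fixes h :: "(nat \<Rightarrow> nat) \<Rightarrow> 'a :: {banach, second_countable_topology}"
  shows "cylindrical n h \<Longrightarrow> integral\<^sup>L \<mu> h = (\<Sum>j<M n. h (vdigit m j)) /\<^sub>R real (M n)"
  using has_integral_cylindrical has_bochner_integral_integral_eq by blast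

lemma integrable_cylindrical:
  fixes h :: "(nat \<Rightarrow> nat) \<Rightarrow> 'a :: {banach, second_countable_topology}"
  shows "cylindrical n h \<Longrightarrow> integrable \<mu> h"
  using has_integral_cylindrical integrable.intros by blast

section \<open>Translations of the group\<close>

definition vadd :: "(nat \<Rightarrow> nat) \<Rightarrow> (nat \<Rightarrow> nat) \<Rightarrow> nat \<Rightarrow> nat" where
  "vadd x a = (\<lambda>k. (x k + a k) mod m k)"

text \<open>The outer \<open>mod\<close> matters where \<open>a k = 0\<close>: there
  \<open>m k - a k\<close> is \<open>m k\<close> itself.\<close>

definition vneg :: "(nat \<Rightarrow> nat) \<Rightarrow> nat \<Rightarrow> nat" where
  "vneg a = (\<lambda>k. (m k - a k) mod m k)"

lemma vadd_in_G [simp]: "vadd x a \<in> G"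
  by (simp add: vadd_def vgroup_def m_pos)

lemma vneg_in_G [simp]: "vneg a \<in> G"
  by (simp add: vneg_def vgroup_def m_pos)

lemma cylindrical_vadd: "cylindrical n h \<Longrightarrow> cylindrical n (\<lambda>x. h (vadd x a))"
  unfolding cylindrical_def by (simp add: vadd_def vgroup_def m_pos)

lemma measurable_vadd: "(\<lambda>x. vadd x a) \<in> \<mu> \<rightarrow>\<^sub>M \<mu>"
proof -
  let ?U = "\<lambda>k. uniform_count_measure {..<m k}"
  have "(\<lambda>x k. (x k + a k) mod m k) \<in> PiM UNIV ?U \<rightarrow>\<^sub>M PiM UNIV ?U"
  proof (rule measurable_PiM_single')
    fix i :: nat
    have "(\<lambda>z. (z + a i) mod m i) \<in> ?U i \<rightarrow>\<^sub>M ?U i"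
      by (auto simp: measurable_def space_uniform_count_measure sets_uniform_count_measure m_pos)
    then show "(\<lambda>x. (x i + a i) mod m i) \<in> PiM UNIV ?U \<rightarrow>\<^sub>M ?U i"
      by (rule measurable_compose[rotated]) simp
  qed (auto simp: space_PiM space_uniform_count_measure m_pos)
  then show ?thesis unfolding vadd_def vmeasure_def .
qed

lemma integral_vadd:
  fixes h :: "(nat \<Rightarrow> nat) \<Rightarrow> 'a :: {banach, second_countable_topology}"
  assumes "cylindrical n h" "a \<in> G"
  shows "(\<integral>x. h (vadd x a) \<partial>\<mu>) = integral\<^sup>L \<mu> h"
proof -
  have "integral\<^sup>L (distr \<mu> \<mu> (\<lambda>x. vadd x a)) h = (\<integral>x. h (vadd x a) \<partial>\<mu>)"
    using integrable_cylindrical[OF assms(1)]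
    by (intro integral_distr measurable_vadd) auto
  then show ?thesis
    using vmeasure_translation_invariant[of m a] two_le assms(2) by (simp add: vadd_def)
qed

section \<open>Characters\<close>

lemma rad_vadd: "rad k (vadd x a) = rad k x * rad k a"
proof -
  have "rad k (vadd x a) = exp (2 * of_real pi * \<i> * of_nat (x k + a k) / of_nat (m k))"
    unfolding vrademacher_def vadd_def using m_pos[of k]
    by (subst complex_root_unity_eq) auto
  then show ?thesis
    by (simp add: vrademacher_def exp_add[symmetric] add_divide_distrib distrib_left)
qed

lemma norm_rad [simp]: "norm (rad k x) = 1"
proof -
  have "rad k x = exp (\<i> * of_real (2 * pi * x k / m k))"
    by (simp add: vrademacher_def mult_ac)
  then show ?thesis by (simp only: norm_exp_i_times)
qed

lemma rad_power_eq_exp: "rad k x ^ j = exp (2 * of_real pi * \<i> * of_nat (j * x k) / of_nat (m k))"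
  by (simp add: vrademacher_def exp_of_nat_mult[symmetric] mult_ac)

lemma rad_power_m: "rad k x ^ m k = 1"
  unfolding rad_power_eq_exp using complex_root_unity_eq[of "m k" "m k * x k" 0] m_pos[of k] by simp

lemma rad_eq_1: "x \<in> G \<Longrightarrow> rad k x = 1 \<longleftrightarrow> x k = 0"
  using complex_root_unity_eq[of "m k" "x k" 0] m_pos[of k] by (auto simp: vrademacher_def vgroup_def)

lemma sum_rad: "x \<in> G \<Longrightarrow> (\<Sum>i<m k. rad k x ^ i) = (if x k = 0 then of_nat (m k) else 0)"
  using geometric_sum[of "rad k x" "m k"] rad_eq_1[of x k] by (auto simp: rad_power_m)

lemma vilenkin_prod: "n < M N \<Longrightarrow> \<psi> n x = (\<Prod>k<N. rad k x ^ vdigit m n k)"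
  unfolding vilenkin_def
proof (rule prod.mono_neutral_left)
  assume "n < M N"
  then show "{k. vdigit m n k \<noteq> 0} \<subseteq> {..<N}"
    using vdigit_eq_0_above[of n N] by (metis (mono_tags, lifting) lessThan_iff mem_Collect_eq not_less subsetI)
qed auto

lemma vilenkin_vadd: "\<psi> n (vadd x a) = \<psi> n x * \<psi> n a"
  by (simp add: vilenkin_def rad_vadd power_mult_distrib prod.distrib)

lemma norm_vilenkin [simp]: "norm (\<psi> n x) = 1"
  by (simp add: vilenkin_def prod_norm[symmetric] norm_power)

lemma vilenkin_mult_cnj [simp]: "\<psi> n x * cnj (\<psi> n x) = 1"
  by (simp add: complex_norm_square[symmetric])

lemma vilenkin_0 [simp]: "\<psi> 0 x = 1"
  by (simp add: vilenkin_def vdigit_def)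

lemma vilenkin_zero [simp]: "\<psi> n (\<lambda>k. 0) = 1"
  by (simp add: vilenkin_def vrademacher_def)

lemma vilenkin_vneg: assumes "a \<in> G" shows "\<psi> n (vneg a) = cnj (\<psi> n a)"
proof -
  have "vadd (vneg a) a = (\<lambda>k. 0)"
  proof
    fix k
    have "a k < m k" using assms by (simp add: vgroup_def)
    then show "vadd (vneg a) a k = 0"
      by (cases "a k = 0") (auto simp: vadd_def vneg_def)
  qed
  then have "\<psi> n (vneg a) * \<psi> n a = 1"
    using vilenkin_vadd[of n "vneg a" a] by simp
  then have "\<psi> n (vneg a) * (\<psi> n a * cnj (\<psi> n a)) = cnj (\<psi> n a)"
    by (simp only: mult.assoc[symmetric] mult_1)
  then show ?thesis by simp
qed

lemma cylindrical_rad: "k < n \<Longrightarrow> cylindrical n (rad k)"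
  unfolding cylindrical_def vrademacher_def by auto

lemma cylindrical_vilenkin: "n < M N \<Longrightarrow> cylindrical N (\<psi> n)"
proof -
  assume n: "n < M N"
  have "cylindrical N (\<lambda>x. \<Prod>k<N. rad k x ^ vdigit m n k)"
    by (intro cylindrical_prod cylindrical_comp[of _ _ "\<lambda>z. z ^ _"] cylindrical_rad) auto
  also have "(\<lambda>x. \<Prod>k<N. rad k x ^ vdigit m n k) = \<psi> n"
    by (rule ext) (rule vilenkin_prod[OF n, symmetric])
  finally show ?thesis .
qed

text \<open>Putting a digit \<open>a\<close> on top of the digits of \<open>r\<close> multiplies the
  character by \<open>rad A x ^ a\<close>. All recursions for the kernels start from this.\<close>

lemma vilenkin_block:
  assumes "r < M A" "a < m A"
  shows "\<psi> (a * M A + r) x = rad A x ^ a * \<psi> r x"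
proof -
  have "\<psi> (a * M A + r) x = (\<Prod>k<Suc A. rad k x ^ vdigit m (a * M A + r) k)"
    using block_less[OF assms] by (rule vilenkin_prod)
  also have "\<dots> = (\<Prod>k<A. rad k x ^ vdigit m r k) * rad A x ^ a"
    using assms by (simp add: vdigit_low vdigit_top)
  finally show ?thesis using vilenkin_prod[OF assms(1)] by simp
qed

text \<open>Orthogonality by translation invariance: a shift by the unit vector at a position where
  the digits of \<open>j\<close> and \<open>k\<close> differ multiplies the integrand by a constant
  other than 1, so the integral vanishes.\<close>

lemma integral_vilenkin:
  "(\<integral>x. \<psi> j x * cnj (\<psi> k x) \<partial>\<mu>) = (if j = k then 1 else 0)"
proof (cases "j = k")
  case True
  then show ?thesis using prob_space by simp
next
  case False
  define N where "N = max j k"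
  have less: "j < M N" "k < M N"
    using less_M[of N] by (auto simp: N_def)
  with False obtain i where i: "vdigit m j i \<noteq> vdigit m k i" "i < N"
    using vdigit_inj by blast
  define a where "a = (\<lambda>l. if l = i then 1 else 0 :: nat)"
  have a: "a \<in> G" using two_le m_pos by (auto simp: a_def vgroup_def Suc_le_eq[symmetric] numeral_2_eq_2)
  have \<psi>a: "\<psi> n a = exp (2 * of_real pi * \<i> * of_nat (vdigit m n i) / of_nat (m i))" if "n < M N" for n
  proof -
    have "\<psi> n a = (\<Prod>l<N. if l = i then rad i a ^ vdigit m n i else 1)"
      unfolding vilenkin_prod[OF that] by (intro prod.cong) (auto simp: a_def vrademacher_def)
    also have "\<dots> = rad i a ^ vdigit m n i"
      using i by (simp add: prod.delta)
    finally show ?thesis unfolding rad_power_eq_exp by (simp add: a_def)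
  qed
  let ?h = "\<lambda>x. \<psi> j x * cnj (\<psi> k x)"
  have cyl: "cylindrical N ?h"
    by (intro cylindrical_comp2[where F = "\<lambda>u v. u * cnj v"] cylindrical_vilenkin less)
  have "integral\<^sup>L \<mu> ?h = (\<integral>x. ?h (vadd x a) \<partial>\<mu>)"
    using integral_vadd[OF cyl a] by simp
  also have "\<dots> = (\<integral>x. ?h a * ?h x \<partial>\<mu>)"
    by (simp add: vilenkin_vadd mult_ac)
  also have "\<dots> = ?h a * integral\<^sup>L \<mu> ?h"
    by simp
  finally have "(1 - ?h a) * integral\<^sup>L \<mu> ?h = 0"
    by (simp add: algebra_simps)
  moreover have "?h a \<noteq> 1"
  proof
    assume "?h a = 1"
    then have "\<psi> j a * (cnj (\<psi> k a) * \<psi> k a) = \<psi> k a"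
      by (simp add: mult.assoc[symmetric])
    then have "\<psi> j a = \<psi> k a"
      by (simp add: mult.commute[of "cnj _"])
    then have "vdigit m j i mod m i = vdigit m k i mod m i"
      using complex_root_unity_eq[of "m i"] \<psi>a less m_pos[of i] by simp
    then show False using i vdigit_less by simp
  qed
  ultimately show ?thesis using False by simp
qed

section \<open>Dirichlet and Fejer kernels\<close>

definition dirichlet :: "nat \<Rightarrow> (nat \<Rightarrow> nat) \<Rightarrow> complex" where
  "dirichlet n x = (\<Sum>j<n. \<psi> j x)"

text \<open>This is \<open>n\<close> times the usual Fejer kernel \<open>K\<^sub>n\<close>.\<close>

definition fejer :: "nat \<Rightarrow> (nat \<Rightarrow> nat) \<Rightarrow> complex" where
  "fejer n x = (\<Sum>k=1..n. dirichlet k x)"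

lemma dirichlet_0 [simp]: "dirichlet 0 x = 0"
  and dirichlet_Suc: "dirichlet (Suc n) x = dirichlet n x + \<psi> n x"
  by (simp_all add: dirichlet_def)

lemma fejer_0 [simp]: "fejer 0 x = 0"
  and fejer_Suc: "fejer (Suc n) x = fejer n x + dirichlet (Suc n) x"
  by (simp_all add: fejer_def)

lemma fejer_eq: "fejer n x = (\<Sum>j<n. of_nat (n - j) * \<psi> j x)"
  unfolding fejer_def dirichlet_def by (rule sum_partial_sums)

lemma cylindrical_dirichlet: "n \<le> M N \<Longrightarrow> cylindrical N (dirichlet n)"
  unfolding dirichlet_def[abs_def] by (intro cylindrical_sum cylindrical_vilenkin) auto

lemma cylindrical_fejer: "n \<le> M N \<Longrightarrow> cylindrical N (fejer n)"
  unfolding fejer_def[abs_def] by (intro cylindrical_sum cylindrical_dirichlet) auto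

lemma dirichlet_block:
  assumes "r \<le> M A" "a < m A"
  shows "dirichlet (a * M A + r) x = dirichlet (a * M A) x + rad A x ^ a * dirichlet r x"
  using assms(1)
proof (induction r)
  case (Suc r)
  then show ?case
    using vilenkin_block[of r A a x] assms(2) by (simp add: dirichlet_Suc distrib_left)
qed simp

lemma dirichlet_multiple:
  "a \<le> m A \<Longrightarrow> dirichlet (a * M A) x = (\<Sum>i<a. rad A x ^ i) * dirichlet (M A) x"
proof (induction a)
  case (Suc a)
  then show ?case
    using dirichlet_block[of "M A" A a x] by (simp add: add.commute distrib_right)
qed simp

text \<open>Passing from \<open>A\<close> to \<open>Suc A\<close> multiplies the kernel by the sum
  of the first \<open>m A\<close> powers of \<open>rad A x\<close>, which is \<open>m A\<close> if
  \<open>x A = 0\<close> and 0 otherwise.\<close>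

lemma dirichlet_M:
  assumes "x \<in> G"
  shows "dirichlet (M A) x = (if \<forall>k<A. x k = 0 then of_nat (M A) else 0)"
proof (induction A)
  case 0
  then show ?case by (simp add: dirichlet_def)
next
  case (Suc A)
  then show ?case
    using dirichlet_multiple[of "m A" A x] sum_rad[OF assms, of A] by (auto simp: less_Suc_eq)
qed

text \<open>Each of the last \<open>r\<close> Dirichlet kernels splits by
  \<open>dirichlet_block\<close> into the common part \<open>dirichlet (a * M A)\<close> and a
  modulated kernel of order at most \<open>r\<close>.\<close>

lemma fejer_block:
  assumes "r \<le> M A" "a < m A"
  shows "fejer (a * M A + r) x
    = fejer (a * M A) x + of_nat r * dirichlet (a * M A) x + rad A x ^ a * fejer r x"
  using assms(1)
proof (induction r)
  case (Suc r)
  then show ?case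
    using dirichlet_block[of "Suc r" A a x] assms(2) by (simp add: fejer_Suc algebra_simps)
qed simp

lemma fejer_multiple:
  "a \<le> m A \<Longrightarrow> fejer (a * M A) x
    = of_nat (M A) * (\<Sum>j<a. dirichlet (j * M A) x) + (\<Sum>j<a. rad A x ^ j) * fejer (M A) x"
proof (induction a)
  case (Suc a)
  then show ?case
    using fejer_block[of "M A" A a x] by (simp add: add.commute algebra_simps)
qed simp

lemma norm_sum_rad_le: "norm (\<Sum>j<a. rad A x ^ j) \<le> real a"
  using norm_sum[of "\<lambda>j. rad A x ^ j" "{..<a}"] by (simp add: norm_power)

lemma norm_dirichlet_multiple_le:
  "a \<le> m A \<Longrightarrow> norm (dirichlet (a * M A) x) \<le> real a * norm (dirichlet (M A) x)"
  using norm_sum_rad_le[of A x a]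
  by (simp add: dirichlet_multiple norm_mult mult_right_mono)

lemma norm_sum_dirichlet_le:
  assumes "a \<le> m A"
  shows "norm (\<Sum>j<a. dirichlet (j * M A) x) \<le> (real a)\<^sup>2 * norm (dirichlet (M A) x)"
proof -
  have "norm (\<Sum>j<a. dirichlet (j * M A) x) \<le> (\<Sum>j<a. real a * norm (dirichlet (M A) x))"
  proof (rule order_trans[OF norm_sum sum_mono])
    fix j assume "j \<in> {..<a}"
    then have "j < a" by simp
    then have "norm (dirichlet (j * M A) x) \<le> real j * norm (dirichlet (M A) x)"
      using assms by (intro norm_dirichlet_multiple_le) simp
    also have "\<dots> \<le> real a * norm (dirichlet (M A) x)"
      using \<open>j < a\<close> by (intro mult_right_mono) auto
    finally show "norm (dirichlet (j * M A) x) \<le> real a * norm (dirichlet (M A) x)" .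
  qed
  then show ?thesis by (simp add: power2_eq_square mult.assoc)
qed

text \<open>The sum of powers of \<open>rad A x\<close> is kept rather than estimated by
  \<open>a\<close>: for \<open>a = m A\<close> it vanishes unless \<open>x A = 0\<close>, and
  \<open>Lhalf_fejer_M\<close> depends on this gain.\<close>

lemma norm_fejer_multiple_le:
  assumes "a \<le> m A"
  shows "norm (fejer (a * M A) x) \<le> (real a)\<^sup>2 * real (M A) * norm (dirichlet (M A) x)
    + norm (\<Sum>j<a. rad A x ^ j) * norm (fejer (M A) x)"
proof -
  have "real (M A) * norm (\<Sum>j<a. dirichlet (j * M A) x)
      \<le> real (M A) * ((real a)\<^sup>2 * norm (dirichlet (M A) x))"
    by (intro mult_left_mono norm_sum_dirichlet_le assms) simp
  then show ?thesis
    using norm_triangle_ineq[of "of_nat (M A) * (\<Sum>j<a. dirichlet (j * M A) x)"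
        "(\<Sum>j<a. rad A x ^ j) * fejer (M A) x"]
    by (simp add: fejer_multiple[OF assms] norm_mult mult_ac)
qed

section \<open>The quasi-norm of L1/2\<close>

text \<open>This is the square root of the quasi-norm of L1/2. It is subadditive, at the price of
  being homogeneous of degree 1/2.\<close>

definition Lhalf :: "((nat \<Rightarrow> nat) \<Rightarrow> complex) \<Rightarrow> real" where
  "Lhalf h = (\<integral>x. sqrt (norm (h x)) \<partial>\<mu>)"

lemma cylindrical_sqrt_norm: "cylindrical n h \<Longrightarrow> cylindrical n (\<lambda>x. sqrt (norm (h x)))"
  by (rule cylindrical_comp)

lemma integrable_sqrt_norm: "cylindrical n h \<Longrightarrow> integrable \<mu> (\<lambda>x. sqrt (norm (h x)))"
  by (intro integrable_cylindrical cylindrical_sqrt_norm)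

lemma Lhalf_nonneg: "0 \<le> Lhalf h"
  by (simp add: Lhalf_def)

lemma Lhalf_cmult: "Lhalf (\<lambda>x. c * h x) = sqrt (norm c) * Lhalf h"
  by (simp add: Lhalf_def norm_mult real_sqrt_mult)

lemma Lhalf_cong: "(\<And>x. x \<in> G \<Longrightarrow> norm (f x) = norm (g x)) \<Longrightarrow> Lhalf f = Lhalf g"
  unfolding Lhalf_def by (intro Bochner_Integration.integral_cong) auto

lemma Lhalf_add:
  assumes "cylindrical n f" "cylindrical n g"
  shows "Lhalf (\<lambda>x. f x + g x) \<le> Lhalf f + Lhalf g"
proof -
  have "Lhalf (\<lambda>x. f x + g x) \<le> (\<integral>x. sqrt (norm (f x)) + sqrt (norm (g x)) \<partial>\<mu>)"
    unfolding Lhalf_def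
    by (intro integral_mono sqrt_norm_add_le Bochner_Integration.integrable_add
        integrable_sqrt_norm[OF cylindrical_comp2[where F = "(+)", OF assms]]
        assms[THEN integrable_sqrt_norm])
  also have "\<dots> = Lhalf f + Lhalf g"
    unfolding Lhalf_def
    by (intro Bochner_Integration.integral_add assms[THEN integrable_sqrt_norm])
  finally show ?thesis .
qed

lemma Lhalf_diff:
  assumes "cylindrical n f" "cylindrical n g"
  shows "Lhalf (\<lambda>x. f x - g x) \<le> Lhalf f + Lhalf g"
  using Lhalf_add[OF assms(1) cylindrical_comp[where F = uminus, OF assms(2)]]
    Lhalf_cmult[of "-1" g] by simp

text \<open>The kernel is \<open>M A\<close> on an interval of measure \<open>1 / M A\<close> and 0
  elsewhere. The only sample point in that interval comes from \<open>j = 0\<close>.\<close>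

lemma Lhalf_dirichlet_M: "Lhalf (dirichlet (M A)) = 1 / sqrt (M A)"
proof -
  have cyl: "cylindrical A (\<lambda>x. sqrt (norm (dirichlet (M A) x)))"
    by (intro cylindrical_sqrt_norm cylindrical_dirichlet) simp
  have "sqrt (norm (dirichlet (M A) (vdigit m j))) = (if j = 0 then sqrt (M A) else 0)"
    if j: "j < M A" for j
  proof (cases "j = 0")
    case True
    then show ?thesis by (simp add: dirichlet_M vdigit_in_G) (simp add: vdigit_def)
  next
    case False
    have "\<exists>k<A. vdigit m j k \<noteq> 0"
    proof (rule ccontr)
      assume "\<not> ?thesis"
      then have "vdigit m j k = vdigit m 0 k" if "k < A" for k
        using that by (simp add: vdigit_def)
      with False j show False using vdigit_inj[of j A 0] by auto
    qed
    with False show ?thesis by (auto simp: dirichlet_M vdigit_in_G)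
  qed
  then have "(\<Sum>j<M A. sqrt (norm (dirichlet (M A) (vdigit m j)))) = sqrt (M A)"
    using M_pos[of A] by (simp add: sum.delta)
  then show ?thesis
    using M_pos[of A] by (simp add: Lhalf_def integral_cylindrical[OF cyl] real_div_sqrt
        divide_inverse[symmetric] field_simps)
qed

text \<open>The coordinate \<open>x A\<close> is independent of \<open>h\<close>, so the restriction
  costs its probability \<open>1 / m A\<close>. In terms of sample points, \<open>x A = 0\<close>
  selects the numbers below \<open>M A\<close> among those below \<open>M (Suc A)\<close>.\<close>

lemma Lhalf_restrict:
  assumes "cylindrical A h"
  shows "(\<integral>x. (if x A = 0 then sqrt (norm (h x)) else 0) \<partial>\<mu>) = Lhalf h / m A"
proof -
  let ?f = "\<lambda>x. if x A = 0 then sqrt (norm (h x)) else 0"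
  have cyl: "cylindrical (Suc A) ?f"
    using cylindrical_comp2[OF cylindrical_coord[of A "Suc A"]
        cylindrical_mono[OF assms, of "Suc A"], where F = "\<lambda>u v. if u = 0 then sqrt (norm v) else 0"]
    by simp
  have "(\<Sum>j<M (Suc A). ?f (vdigit m j)) = (\<Sum>j<M A. sqrt (norm (h (vdigit m j))))"
  proof (rule sum.mono_neutral_cong_right)
    show "{..<M A} \<subseteq> {..<M (Suc A)}" using M_mono[of A "Suc A"] by auto
    show "\<forall>j\<in>{..<M (Suc A)} - {..<M A}. ?f (vdigit m j) = 0"
    proof
      fix j assume j: "j \<in> {..<M (Suc A)} - {..<M A}"
      then have "0 < j div M A" "j div M A < m A"
        using M_pos[of A] by (auto simp: div_greater_zero_iff not_less less_mult_imp_div_less)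
      then show "?f (vdigit m j) = 0" by (simp add: vdigit_def)
    qed
  qed (auto simp: vdigit_eq_0)
  then show ?thesis
    by (simp add: integral_cylindrical[OF cyl] Lhalf_def
        integral_cylindrical[OF cylindrical_sqrt_norm[OF assms]] field_simps)
qed

section \<open>Upper bound for the Fejer kernels\<close>

text \<open>Writing \<open>L A\<close> for the left side, one step gives
  \<open>L (Suc A) \<le> m A + L A / sqrt (m A)\<close>: the sum of powers contributes
  \<open>sqrt (m A)\<close> and its support \<open>x A = 0\<close> the factor
  \<open>1 / m A\<close>. As \<open>m A \<ge> 2\<close>, this is a contraction, and the bound
  \<open>4 * B\<close> reproduces itself.\<close>

lemma Lhalf_fejer_M: "Lhalf (fejer (M A)) \<le> 4 * real B"
proof (induction A)
  case 0
  have "Lhalf (fejer (M 0)) = 1"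
    using prob_space by (simp add: Lhalf_def fejer_def dirichlet_def)
  then show ?case using B_ge by simp
next
  case (Suc A)
  have cylD: "cylindrical A (dirichlet (M A))" and cylF: "cylindrical A (fejer (M A))"
    by (simp_all add: cylindrical_dirichlet cylindrical_fejer)
  let ?d = "\<lambda>x. sqrt (norm (dirichlet (M A) x))"
  let ?g = "\<lambda>x. if x A = 0 then sqrt (norm (fejer (M A) x)) else 0"
  have intg: "integrable \<mu> ?g"
    using cylindrical_comp2[OF cylindrical_coord[of A "Suc A"]
        cylindrical_mono[OF cylF, of "Suc A"], where F = "\<lambda>u v. if u = 0 then sqrt (norm v) else 0"]
    by (intro integrable_cylindrical[of "Suc A"]) simp
  have intd: "integrable \<mu> ?d"
    by (rule integrable_sqrt_norm[OF cylD])
  have pt: "sqrt (norm (fejer (M (Suc A)) x)) \<le> real (m A) * sqrt (M A) * ?d x + sqrt (m A) * ?g x"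
    if x: "x \<in> G" for x
  proof -
    have "norm (fejer (M (Suc A)) x) \<le> (real (m A))\<^sup>2 * real (M A) * norm (dirichlet (M A) x)
        + (if x A = 0 then real (m A) else 0) * norm (fejer (M A) x)"
      using norm_fejer_multiple_le[of "m A" A x] sum_rad[OF x, of A] by (simp split: if_splits)
    then have "sqrt (norm (fejer (M (Suc A)) x))
        \<le> sqrt ((real (m A))\<^sup>2 * real (M A) * norm (dirichlet (M A) x))
          + sqrt ((if x A = 0 then real (m A) else 0) * norm (fejer (M A) x))"
      by (intro order_trans[OF real_sqrt_le_mono sqrt_add_le_add_sqrt]) auto
    then show ?thesis by (cases "x A = 0") (simp_all add: real_sqrt_mult)
  qed
  have "Lhalf (fejer (M (Suc A))) \<le> (\<integral>x. real (m A) * sqrt (M A) * ?d x + sqrt (m A) * ?g x \<partial>\<mu>)"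
    unfolding Lhalf_def using pt
    by (intro integral_mono Bochner_Integration.integrable_add integrable_mult_right intg intd
        integrable_sqrt_norm[OF cylindrical_fejer[OF order_refl]]) auto
  also have "\<dots> = real (m A) * sqrt (M A) * Lhalf (dirichlet (M A)) + sqrt (m A) * (Lhalf (fejer (M A)) / m A)"
    using intd intg by (simp add: Lhalf_restrict[OF cylF]) (simp add: Lhalf_def)
  also have "\<dots> = real (m A) + Lhalf (fejer (M A)) / sqrt (m A)"
    using M_pos[of A] m_pos[of A]
    by (simp add: Lhalf_dirichlet_M field_simps)
  also have "\<dots> \<le> real B + 4 * real B / sqrt 2"
    using le_B[of A] two_le[of A] Suc m_pos[of A]
    by (intro add_mono frac_le) (auto intro: Lhalf_nonneg)
  also have "\<dots> \<le> real B + 3 * real B"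
  proof -
    have "4 / 3 \<le> sqrt (2::real)"
      by (rule real_le_rsqrt) (simp add: power2_eq_square)
    then have "4 / sqrt 2 \<le> (3::real)"
      by (simp add: field_simps)
    then show ?thesis
      using mult_right_mono[of "4 / sqrt 2" 3 "real B"] by simp
  qed
  finally show ?case by simp
qed

text \<open>Splitting off the leading digit \<open>a\<close> of \<open>n\<close> costs at most
  \<open>5 * B ^ 2\<close>: the Dirichlet kernels contribute \<open>B ^ 2\<close> and the kernel of
  order \<open>M A\<close> contributes \<open>4 * B ^ 2\<close>. The remainder \<open>r\<close> has
  one digit less.\<close>

lemma Lhalf_fejer_less:
  "n < M A \<Longrightarrow> Lhalf (fejer n) \<le> real A * (5 * (real B)\<^sup>2)"
proof (induction A arbitrary: n)
  case 0
  then show ?case by (simp add: Lhalf_def)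
next
  case (Suc A)
  define a r where "a = n div M A" and "r = n mod M A"
  have n: "n = a * M A + r" and r: "r < M A" and a: "a < m A"
    using Suc.prems M_pos[of A] by (simp_all only: a_def r_def div_mult_mod_eq vM.simps
        less_mult_imp_div_less mod_less_divisor)
  have cylD: "cylindrical A (dirichlet (M A))" and cylF: "cylindrical A (fejer (M A))"
    and cylR: "cylindrical A (fejer r)"
    using r by (simp_all add: cylindrical_dirichlet cylindrical_fejer)
  \<comment> \<open>The factor 2 collects two Dirichlet terms, one inside
    \<open>fejer (a * M A)\<close> and one from \<open>r * dirichlet (a * M A)\<close> with
    \<open>r < M A\<close>.\<close>
  let ?c = "2 * (real B)\<^sup>2 * real (M A)"
  have aB: "real a \<le> B" using a le_B[of A] by simp
  have pt: "sqrt (norm (fejer n x)) \<le> sqrt ?c * sqrt (norm (dirichlet (M A) x))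
      + real B * sqrt (norm (fejer (M A) x)) + sqrt (norm (fejer r x))" for x
  proof -
    let ?d = "norm (dirichlet (M A) x)" and ?f = "norm (fejer (M A) x)"
    have "norm (fejer n x) \<le> norm (fejer (a * M A) x) + real r * norm (dirichlet (a * M A) x)
        + norm (fejer r x)"
      unfolding n using r a
      by (subst fejer_block) (auto intro!: order_trans[OF norm_triangle_ineq] add_mono
          simp: norm_mult norm_power)
    also have "norm (fejer (a * M A) x) \<le> (real a)\<^sup>2 * real (M A) * ?d + real a * ?f"
      using a by (intro order_trans[OF norm_fejer_multiple_le] add_left_mono mult_right_mono
          norm_sum_rad_le) auto
    also have "(real a)\<^sup>2 * real (M A) * ?d \<le> (real B)\<^sup>2 * real (M A) * ?d"
      using aB by (intro mult_right_mono power_mono) auto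
    also have "real a * ?f \<le> (real B)\<^sup>2 * ?f"
    proof (rule mult_right_mono)
      have "real B * 1 \<le> real B * real B" using B_ge by (intro mult_left_mono) auto
      with aB show "real a \<le> (real B)\<^sup>2" by (simp add: power2_eq_square)
    qed simp
    also have "real r * norm (dirichlet (a * M A) x) \<le> real (M A) * (real a * ?d)"
      using a r by (intro mult_mono norm_dirichlet_multiple_le) auto
    also have "\<dots> \<le> (real B)\<^sup>2 * real (M A) * ?d"
    proof -
      have "real B * 1 \<le> real B * real B" using B_ge by (intro mult_left_mono) auto
      with aB have "real a \<le> (real B)\<^sup>2" by (simp add: power2_eq_square)
      then have "real a * (real (M A) * ?d) \<le> (real B)\<^sup>2 * (real (M A) * ?d)"
        by (intro mult_right_mono) auto
      then show ?thesis by (simp add: mult_ac)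
    qed
    finally have "norm (fejer n x) \<le> ?c * ?d + (real B)\<^sup>2 * ?f + norm (fejer r x)"
      by (simp add: mult_ac)
    then have "sqrt (norm (fejer n x)) \<le> sqrt (?c * ?d + (real B)\<^sup>2 * ?f + norm (fejer r x))"
      by (rule real_sqrt_le_mono)
    also have "\<dots> \<le> sqrt (?c * ?d + (real B)\<^sup>2 * ?f) + sqrt (norm (fejer r x))"
      by (rule sqrt_add_le_add_sqrt) auto
    also have "sqrt (?c * ?d + (real B)\<^sup>2 * ?f) \<le> sqrt (?c * ?d) + sqrt ((real B)\<^sup>2 * ?f)"
      by (rule sqrt_add_le_add_sqrt) auto
    finally have "sqrt (norm (fejer n x)) \<le> sqrt (?c * ?d) + sqrt ((real B)\<^sup>2 * ?f) + sqrt (norm (fejer r x))"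
      by simp
    then show ?thesis by (simp add: real_sqrt_mult)
  qed
  have ints: "integrable \<mu> (\<lambda>x. sqrt (norm (dirichlet (M A) x)))"
    "integrable \<mu> (\<lambda>x. sqrt (norm (fejer (M A) x)))" "integrable \<mu> (\<lambda>x. sqrt (norm (fejer r x)))"
    using cylD cylF cylR by (auto intro: integrable_sqrt_norm)
  have "Lhalf (fejer n) \<le> (\<integral>x. sqrt ?c * sqrt (norm (dirichlet (M A) x))
      + real B * sqrt (norm (fejer (M A) x)) + sqrt (norm (fejer r x)) \<partial>\<mu>)"
    unfolding Lhalf_def using pt Suc.prems ints
    by (intro integral_mono Bochner_Integration.integrable_add integrable_mult_right
        integrable_sqrt_norm[OF cylindrical_fejer[of n "Suc A"]]) auto
  also have "\<dots> = sqrt ?c * Lhalf (dirichlet (M A)) + real B * Lhalf (fejer (M A)) + Lhalf (fejer r)"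
    using ints by (simp add: Lhalf_def)
  also have "sqrt ?c * Lhalf (dirichlet (M A)) = sqrt 2 * real B"
    using M_pos[of A] by (simp add: Lhalf_dirichlet_M real_sqrt_mult)
  also have "real B * Lhalf (fejer (M A)) \<le> real B * (4 * real B)"
    by (intro mult_left_mono Lhalf_fejer_M) simp
  also have "Lhalf (fejer r) \<le> real A * (5 * (real B)\<^sup>2)"
    by (rule Suc.IH[OF r])
  also have "sqrt 2 * real B \<le> real B * real B"
    using B_ge sqrt2_less_2 by (intro mult_right_mono) auto
  finally show ?case
    by (simp add: algebra_simps power2_eq_square)
qed

lemma Lhalf_fejer_le:
  "n \<le> M A \<Longrightarrow> Lhalf (fejer n) \<le> real (Suc A) * (5 * (real B)\<^sup>2)"
  using M_double[of A] M_pos[of A] by (intro Lhalf_fejer_less) linarith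

section \<open>Martingales as Fourier series\<close>

text \<open>Martingales are represented by coefficient sequences: every sequence gives one by
  \<open>vmartingale_partial_series\<close>, and \<open>vmartingale_eq_partial_series\<close> shows
  that on \<open>G\<close> there are no others.\<close>

definition partial_series :: "(nat \<Rightarrow> complex) \<Rightarrow> vprocess" where
  "partial_series c k x = (\<Sum>j<M k. c j * \<psi> j x)"

text \<open>This is the martingale difference between the stages \<open>i\<close> and
  \<open>Suc i\<close>.\<close>

definition block :: "(nat \<Rightarrow> complex) \<Rightarrow> nat \<Rightarrow> (nat \<Rightarrow> nat) \<Rightarrow> complex" where
  "block c i x = (\<Sum>j=M i..<M (Suc i). c j * \<psi> j x)"

lemma partial_series_Suc: "partial_series c (Suc i) x = partial_series c i x + block c i x"
proof -
  have "M i \<le> M (Suc i)" by (rule M_mono) simp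
  then show ?thesis
    unfolding partial_series_def block_def lessThan_atLeast0
    by (simp only: sum.atLeastLessThan_concat[of 0 "M i" "M (Suc i)"])
qed

lemma partial_series_add:
  "partial_series (\<lambda>j. c j + d j) k x = partial_series c k x + partial_series d k x"
  by (simp add: partial_series_def distrib_right sum.distrib)

text \<open>This presents a block as a polynomial with spectrum below \<open>M (Suc i)\<close> and
  as a stage of the tail of the series.\<close>

lemma partial_series_tail:
  "partial_series (\<lambda>j. if j < M i then 0 else c j) (Suc i) x = block c i x"
proof -
  have "(\<Sum>j<M i. (if j < M i then 0 else c j) * \<psi> j x) = 0"
    by (intro sum.neutral) auto
  then show ?thesis
    unfolding partial_series_Suc by (simp add: partial_series_def block_def)
qed

lemma cylindrical_term: "j < M k \<Longrightarrow> cylindrical k (\<lambda>x. c * \<psi> j x)"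
  by (rule cylindrical_comp) (rule cylindrical_vilenkin)

lemma cylindrical_partial_series: "cylindrical k (partial_series c k)"
  unfolding partial_series_def[abs_def] by (intro cylindrical_sum cylindrical_term) auto

lemma cylindrical_block: "cylindrical (Suc i) (block c i)"
  unfolding block_def[abs_def] by (intro cylindrical_sum cylindrical_term) auto

lemma fourier_coeff_cong: "(\<And>x. x \<in> G \<Longrightarrow> f x = g x) \<Longrightarrow> fourier_coeff m f = fourier_coeff m g"
  unfolding fourier_coeff_def[abs_def]
  by (intro ext Bochner_Integration.integral_cong) auto

lemma fourier_coeff_polynomial:
  "fourier_coeff m (\<lambda>x. \<Sum>j<n. c j * \<psi> j x) k = (if k < n then c k else 0)"
proof -
  have int: "integrable \<mu> (\<lambda>x. \<psi> j x * cnj (\<psi> k x))" for j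
  proof -
    have "j < M (max j k)" "k < M (max j k)"
      using less_M[of "max j k"] by auto
    then show ?thesis
      by (intro integrable_cylindrical cylindrical_comp2[where F = "\<lambda>u v. u * cnj v"]
          cylindrical_vilenkin)
  qed
  have "fourier_coeff m (\<lambda>x. \<Sum>j<n. c j * \<psi> j x) k
      = (\<integral>x. (\<Sum>j<n. c j * (\<psi> j x * cnj (\<psi> k x))) \<partial>\<mu>)"
    by (simp add: fourier_coeff_def sum_distrib_right mult.assoc)
  also have "\<dots> = (\<Sum>j<n. \<integral>x. c j * (\<psi> j x * cnj (\<psi> k x)) \<partial>\<mu>)"
    by (intro Bochner_Integration.integral_sum integrable_mult_right int)
  also have "\<dots> = (\<Sum>j<n. c j * (if j = k then 1 else 0))"
    by (simp add: integral_vilenkin)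
  also have "\<dots> = (if k < n then c k else 0)"
    by (simp add: if_distrib cong: if_cong)
  finally show ?thesis .
qed

lemma fourier_coeff_partial_series:
  "j < M k \<Longrightarrow> fourier_coeff m (partial_series c k) j = c j"
  using fourier_coeff_polynomial[of c "M k" j] by (simp add: partial_series_def[abs_def])

lemma mart_of_polynomial:
  "mart_of m (\<lambda>x. \<Sum>j<n. c j * \<psi> j x) = partial_series (\<lambda>j. if j < n then c j else 0)"
  by (simp add: mart_of_def fourier_sum_def[abs_def] fourier_coeff_polynomial
      partial_series_def[abs_def])

text \<open>A preimage is the union of the finitely many generating intervals whose sample points
  are mapped into the set.\<close>

lemma measurable_vfiltration:
  assumes "cylindrical n (h :: _ \<Rightarrow> 'b :: topological_space)"
  shows "h \<in> borel_measurable (vfiltration m n)"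
proof (rule measurableI)
  have sp: "space (vfiltration m n) = G"
    by (simp add: vfiltration_def space_measure_of_conv)
  have sets: "vinterval m n x \<in> sets (vfiltration m n)" if "x \<in> G" for x
    unfolding vfiltration_def using that
    by (subst sets_measure_of) (auto simp: vinterval_def intro!: sigma_sets.Basic)
  fix A :: "'b set"
  have "h -` A \<inter> space (vfiltration m n)
      = (\<Union>j\<in>{j. j < M n \<and> h (vdigit m j) \<in> A}. vinterval m n (vdigit m j))"
  proof (intro equalityI subsetI)
    fix x assume x: "x \<in> h -` A \<inter> space (vfiltration m n)"
    then have "x \<in> G" by (simp add: sp)
    then obtain j where j: "j < M n" "\<And>k. k < n \<Longrightarrow> vdigit m j k = x k"
      using ex_vdigit by blast
    then have "h (vdigit m j) = h x"
      using \<open>x \<in> G\<close> by (intro cylindricalD[OF assms]) (auto simp: vdigit_in_G)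
    with x j \<open>x \<in> G\<close> show "x \<in> (\<Union>j\<in>{j. j < M n \<and> h (vdigit m j) \<in> A}. vinterval m n (vdigit m j))"
      by (auto simp: vinterval_def)
  next
    fix x assume "x \<in> (\<Union>j\<in>{j. j < M n \<and> h (vdigit m j) \<in> A}. vinterval m n (vdigit m j))"
    then obtain j where j: "h (vdigit m j) \<in> A" "x \<in> G" "\<And>k. k < n \<Longrightarrow> x k = vdigit m j k"
      by (auto simp: vinterval_def)
    then have "h x = h (vdigit m j)"
      by (intro cylindricalD[OF assms]) (auto simp: vdigit_in_G)
    with j show "x \<in> h -` A \<inter> space (vfiltration m n)" by (simp add: sp)
  qed
  also have "\<dots> \<in> sets (vfiltration m n)"
    by (intro sets.finite_UN sets) (auto simp: vdigit_in_G)
  finally show "h -` A \<inter> space (vfiltration m n) \<in> sets (vfiltration m n)" .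
qed simp

lemma vmartingale_partial_series: "vmartingale m (partial_series c)"
  unfolding vmartingale_def
proof (intro conjI allI impI ballI)
  fix n k :: nat and x assume "n \<le> k"
  then have "M n \<le> M k" by (rule M_mono)
  then show "fourier_sum m (M n) (partial_series c k) x = partial_series c n x"
    by (simp add: fourier_sum_def fourier_coeff_partial_series partial_series_def)
qed (rule integrable_cylindrical measurable_vfiltration, rule cylindrical_partial_series)+

lemma mart_coeff_partial_series: "mart_coeff m (partial_series c) j = c j"
proof -
  have "(\<lambda>k. fourier_coeff m (partial_series c k) j) \<longlonglongrightarrow> c j"
  proof (rule tendsto_eventually)
    show "\<forall>\<^sub>F k in sequentially. fourier_coeff m (partial_series c k) j = c j"
      using eventually_ge_at_top[of j]
      by eventually_elim (meson fourier_coeff_partial_series less_M less_le_trans M_mono)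
  qed
  then show ?thesis
    unfolding mart_coeff_def fourier_coeff_def by (rule limI)
qed

text \<open>Consistency makes the coefficients of index below \<open>M n\<close> the same for all
  stages \<open>k \<ge> n\<close>, so the limit defining \<open>mart_coeff\<close> is already
  attained at stage \<open>n\<close>.\<close>

lemma vmartingale_eq_partial_series:
  assumes f: "vmartingale m f" and x: "x \<in> G"
  shows "f n x = partial_series (mart_coeff m f) n x"
proof -
  let ?c = "\<lambda>k. fourier_coeff m (f k)"
  have fs: "f n x = (\<Sum>j<M n. ?c k j * \<psi> j x)" if "n \<le> k" "x \<in> G" for n k x
    using f that by (auto simp: vmartingale_def fourier_sum_def)
  have coeff: "?c n j = ?c k j" if "n \<le> k" "j < M n" for n k j
  proof -
    have "?c n = fourier_coeff m (\<lambda>x. \<Sum>j<M n. ?c k j * \<psi> j x)"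
      by (intro fourier_coeff_cong fs that)
    with that show ?thesis by (simp add: fourier_coeff_polynomial)
  qed
  have mc: "mart_coeff m f j = ?c n j" if "j < M n" for j
  proof -
    have "(\<lambda>k. ?c k j) \<longlonglongrightarrow> ?c n j"
    proof (rule tendsto_eventually)
      show "\<forall>\<^sub>F k in sequentially. ?c k j = ?c n j"
        using eventually_ge_at_top[of n] by eventually_elim (simp add: coeff that)
    qed
    then show ?thesis
      unfolding mart_coeff_def fourier_coeff_def by (rule limI)
  qed
  show ?thesis
    using fs[OF order_refl x] by (simp add: partial_series_def mc)
qed

lemma fejer_mean_eq:
  "fejer_mean m n f x = (\<Sum>j<n. of_nat (n - j) / of_nat n * mart_coeff m f j * \<psi> j x)"
  unfolding fejer_mean_def mart_sum_def sum_partial_sums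
  unfolding sum_divide_distrib by (intro sum.cong) auto

text \<open>These are the coefficients of \<open>\<sigma>\<^sub>n f - f\<close>. For
  \<open>j \<ge> n\<close> the truncated difference is 0 and the multiplier is -1.\<close>

definition fejer_error :: "(nat \<Rightarrow> complex) \<Rightarrow> nat \<Rightarrow> nat \<Rightarrow> complex" where
  "fejer_error c n j = (of_nat (n - j) / of_nat n - 1) * c j"

lemma fejer_error_eq_partial_series:
  assumes "vmartingale m f" "x \<in> G"
  shows "mart_diff (mart_of m (fejer_mean m n f)) f k x
    = partial_series (fejer_error (mart_coeff m f) n) k x"
proof -
  have "mart_of m (fejer_mean m n f)
      = mart_of m (\<lambda>x. \<Sum>j<n. (of_nat (n - j) / of_nat n * mart_coeff m f j) * \<psi> j x)"
    by (rule arg_cong[where f = "mart_of m"]) (rule ext, rule fejer_mean_eq)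
  then have "mart_of m (fejer_mean m n f)
      = partial_series (\<lambda>j. if j < n then of_nat (n - j) / of_nat n * mart_coeff m f j else 0)"
    unfolding mart_of_polynomial .
  then show ?thesis
    unfolding mart_diff_def vmartingale_eq_partial_series[OF assms]
    by (simp add: partial_series_def sum_subtractf[symmetric] fejer_error_def algebra_simps)
      (intro sum.cong; auto simp: algebra_simps)
qed

lemma modulus_eq_partial_series:
  assumes "vmartingale m f" "x \<in> G"
  shows "mart_diff f (mart_of m (mart_sum m (M n) f)) k x
    = partial_series (\<lambda>j. if j < M n then 0 else mart_coeff m f j) k x"
proof -
  have "mart_of m (mart_sum m (M n) f)
      = partial_series (\<lambda>j. if j < M n then mart_coeff m f j else 0)"
    unfolding mart_sum_def[abs_def] by (rule mart_of_polynomial)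
  then show ?thesis
    unfolding mart_diff_def vmartingale_eq_partial_series[OF assms]
    by (simp add: partial_series_def sum_subtractf[symmetric])
      (intro sum.cong; auto simp: algebra_simps)
qed

section \<open>Norms in terms of square roots\<close>

text \<open>This is the square root of the quasi-norm of H1/2, see \<open>Hp_norm_eq\<close>. Like
  \<open>Lhalf\<close> it is subadditive; unlike \<open>Lhalf\<close> it can be infinite.\<close>

definition max_root :: "(nat \<Rightarrow> complex) \<Rightarrow> ennreal" where
  "max_root c = (\<integral>\<^sup>+x. (SUP k. ennreal (sqrt (norm (partial_series c k x)))) \<partial>\<mu>)"

lemma Hp_norm_eq:
  assumes "\<And>k x. x \<in> G \<Longrightarrow> f k x = partial_series c k x"
  shows "Hp_norm m (1/2) f = max_root c * max_root c"
proof -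
  have "(\<integral>\<^sup>+x. ennreal_powr (mart_max f x) (1/2) \<partial>\<mu>) = max_root c"
    unfolding max_root_def mart_max_def ennreal_powr_half_SUP
    by (intro nn_integral_cong SUP_cong) (auto simp: assms ennreal_powr_half)
  then show ?thesis by (simp add: Hp_norm_def Lp_norm_def ennreal_powr_two)
qed

lemma ennreal_Lhalf:
  "cylindrical n h \<Longrightarrow> ennreal (Lhalf h) = (\<integral>\<^sup>+x. ennreal (sqrt (norm (h x))) \<partial>\<mu>)"
  unfolding Lhalf_def by (intro nn_integral_eq_integral[symmetric] integrable_sqrt_norm) auto

lemma Lp_norm_half:
  assumes "cylindrical n h"
  shows "Lp_norm m (1/2) (\<lambda>x. ennreal (norm (h x))) = ennreal (Lhalf h) * ennreal (Lhalf h)"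
  using ennreal_Lhalf[OF assms] by (simp add: Lp_norm_def ennreal_powr_two ennreal_powr_half)

lemma Lhalf_partial_series_le_mart_Lp_norm:
  assumes "\<And>k x. x \<in> G \<Longrightarrow> f k x = partial_series c k x"
  shows "ennreal (Lhalf (partial_series c k)) * ennreal (Lhalf (partial_series c k))
    \<le> mart_Lp_norm m (1/2) f"
proof -
  have "Lp_norm m (1/2) (\<lambda>x. ennreal (norm (partial_series c k x)))
      = Lp_norm m (1/2) (\<lambda>x. ennreal (norm (f k x)))"
    unfolding Lp_norm_def
    by (intro arg_cong[where f = "\<lambda>z. ennreal_powr z _"] nn_integral_cong) (simp add: assms)
  also have "\<dots> \<le> mart_Lp_norm m (1/2) f"
    unfolding mart_Lp_norm_def by (rule SUP_upper) simp
  finally show ?thesis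
    using Lp_norm_half[OF cylindrical_partial_series] by simp
qed

lemma measurable_root:
  "cylindrical n h \<Longrightarrow> (\<lambda>x. ennreal (sqrt (norm (h x)))) \<in> borel_measurable \<mu>"
  by (intro measurable_compose[OF borel_measurable_integrable measurable_ennreal] integrable_sqrt_norm)

lemma Lhalf_partial_series_le: "ennreal (Lhalf (partial_series c k)) \<le> max_root c"
  unfolding max_root_def ennreal_Lhalf[OF cylindrical_partial_series]
  by (intro nn_integral_mono SUP_upper) simp

lemma max_root_add: "max_root (\<lambda>j. c j + d j) \<le> max_root c + max_root d"
proof -
  let ?r = "\<lambda>c k x. ennreal (sqrt (norm (partial_series c k x)))"
  have meas: "(\<lambda>x. SUP k. ?r c k x) \<in> borel_measurable \<mu>" for c
    by (intro borel_measurable_SUP measurable_root[OF cylindrical_partial_series]) auto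
  have "max_root (\<lambda>j. c j + d j) \<le> (\<integral>\<^sup>+x. (SUP k. ?r c k x) + (SUP k. ?r d k x) \<partial>\<mu>)"
    unfolding max_root_def
  proof (intro nn_integral_mono SUP_least)
    fix x k
    have "?r (\<lambda>j. c j + d j) k x \<le> ?r c k x + ?r d k x"
      by (simp add: partial_series_add ennreal_plus[symmetric] sqrt_norm_add_le del: ennreal_plus)
    also have "\<dots> \<le> (SUP k. ?r c k x) + (SUP k. ?r d k x)"
      by (intro add_mono SUP_upper) auto
    finally show "?r (\<lambda>j. c j + d j) k x \<le> (SUP k. ?r c k x) + (SUP k. ?r d k x)" .
  qed
  also have "\<dots> = max_root c + max_root d"
    unfolding max_root_def by (intro nn_integral_add meas)
  finally show ?thesis .
qed

text \<open>Each stage is a sum of blocks, so subadditivity of the root bounds all stages at once.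
  Blocks start at \<open>M 0 = 1\<close>; the constant term belongs to none of them, hence the
  assumption on \<open>c 0\<close>.\<close>

lemma max_root_le_blocks:
  assumes "c 0 = 0"
  shows "max_root c \<le> (\<Sum>i. ennreal (Lhalf (block c i)))"
proof -
  let ?b = "\<lambda>i x. ennreal (sqrt (norm (block c i x)))"
  have "max_root c \<le> (\<integral>\<^sup>+x. (\<Sum>i. ?b i x) \<partial>\<mu>)"
    unfolding max_root_def
  proof (intro nn_integral_mono SUP_least)
    fix x k
    have "partial_series c k x = (\<Sum>i<k. block c i x)"
      by (induction k) (simp_all add: partial_series_Suc, simp add: partial_series_def assms)
    then have "ennreal (sqrt (norm (partial_series c k x))) \<le> ennreal (\<Sum>i<k. sqrt (norm (block c i x)))"
      by (simp add: sqrt_norm_sum_le ennreal_leI del: sum_ennreal)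
    also have "\<dots> = (\<Sum>i<k. ?b i x)"
      by (simp add: sum_ennreal)
    also have "\<dots> \<le> (\<Sum>i. ?b i x)"
      by (intro sum_le_suminf) auto
    finally show "ennreal (sqrt (norm (partial_series c k x))) \<le> (\<Sum>i. ?b i x)" .
  qed
  also have "\<dots> = (\<Sum>i. ennreal (Lhalf (block c i)))"
    by (simp add: nn_integral_suminf measurable_root[OF cylindrical_block] ennreal_Lhalf[OF cylindrical_block])
  finally show ?thesis .
qed

text \<open>The block is stage \<open>Suc i\<close> of \<open>f - S f\<close> with the partial sum
  of order \<open>M i\<close>, so the modulus of continuity controls every single block.\<close>

lemma Lhalf_block_le_tail:
  "ennreal (Lhalf (block c i)) \<le> max_root (\<lambda>j. if j < M i then 0 else c j)"
  using Lhalf_partial_series_le[of "\<lambda>j. if j < M i then 0 else c j" "Suc i"]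
  by (simp add: partial_series_tail[abs_def])

section \<open>Fejer means of polynomials\<close>

text \<open>Each coefficient is an average over sample points, so the polynomial on the left is the
  average of \<open>M N\<close> translates of \<open>fejer n\<close>, weighted by the values of
  \<open>partial_series c N\<close>. Subadditivity and translation invariance separate kernel and
  weights.\<close>

lemma Lhalf_fejer_multiplier:
  assumes n: "n \<le> M N"
  shows "Lhalf (\<lambda>x. \<Sum>j<M N. of_nat (n - j) * c j * \<psi> j x)
    \<le> sqrt (M N) * Lhalf (fejer n) * Lhalf (partial_series c N)"
proof -
  let ?g = "partial_series c N" and ?e = "vdigit m"
  let ?h = "\<lambda>x. \<Sum>j<M N. of_nat (n - j) * c j * \<psi> j x"
  let ?k = "\<lambda>l x. fejer n (vadd x (vneg (?e l)))"
  have c: "c j = (\<Sum>l<M N. ?g (?e l) * cnj (\<psi> j (?e l))) / of_nat (M N)" if "j < M N" for j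
  proof -
    have "c j = (\<integral>x. ?g x * cnj (\<psi> j x) \<partial>\<mu>)"
      using fourier_coeff_partial_series[OF that, of c] by (simp add: fourier_coeff_def)
    also have "\<dots> = (\<Sum>l<M N. ?g (?e l) * cnj (\<psi> j (?e l))) /\<^sub>R real (M N)"
      by (intro integral_cylindrical cylindrical_comp2[where F = "\<lambda>u v. u * cnj v"]
          cylindrical_partial_series cylindrical_vilenkin that)
    finally show ?thesis by (simp add: scaleR_conv_of_real divide_inverse mult.commute)
  qed
  have fej: "fejer n x = (\<Sum>j<M N. of_nat (n - j) * \<psi> j x)" for x
    unfolding fejer_eq using n by (intro sum.mono_neutral_left) auto
  have h: "?h x = (\<Sum>l<M N. ?g (?e l) * ?k l x) / of_nat (M N)" for x
  proof -
    have "?h x = (\<Sum>j<M N. \<Sum>l<M N. ?g (?e l) * (of_nat (n - j) * (\<psi> j x * cnj (\<psi> j (?e l))))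
        / of_nat (M N))"
      by (intro sum.cong refl, subst c) (auto simp: sum_distrib_left sum_distrib_right
          sum_divide_distrib mult_ac)
    also have "\<dots> = (\<Sum>l<M N. \<Sum>j<M N. ?g (?e l) * (of_nat (n - j) * (\<psi> j x * cnj (\<psi> j (?e l))))
        / of_nat (M N))"
      by (rule sum.swap)
    also have "\<dots> = (\<Sum>l<M N. ?g (?e l) * ?k l x / of_nat (M N))"
      unfolding fej by (simp add: vilenkin_vadd vilenkin_vneg vdigit_in_G sum_distrib_left
          sum_divide_distrib)
    finally show ?thesis by (simp add: sum_divide_distrib)
  qed
  have cyl: "cylindrical N (?k l)" for l
    by (intro cylindrical_vadd cylindrical_fejer n)
  have "Lhalf ?h \<le> (\<integral>x. (\<Sum>l<M N. sqrt (norm (?g (?e l))) * sqrt (norm (?k l x))) / sqrt (M N) \<partial>\<mu>)"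
    unfolding Lhalf_def
  proof (rule integral_mono)
    show "integrable \<mu> (\<lambda>x. sqrt (norm (?h x)))"
      by (intro integrable_sqrt_norm[of N] cylindrical_sum cylindrical_term) auto
    show "integrable \<mu> (\<lambda>x. (\<Sum>l<M N. sqrt (norm (?g (?e l))) * sqrt (norm (?k l x))) / sqrt (M N))"
      by (intro integrable_divide Bochner_Integration.integrable_sum integrable_mult_right
          integrable_sqrt_norm[OF cyl])
    fix x
    have "sqrt (norm (?h x)) = sqrt (norm (\<Sum>l<M N. ?g (?e l) * ?k l x)) / sqrt (M N)"
      unfolding h by (simp add: norm_divide real_sqrt_divide)
    also have "\<dots> \<le> (\<Sum>l<M N. sqrt (norm (?g (?e l) * ?k l x))) / sqrt (M N)"
      by (intro divide_right_mono sqrt_norm_sum_le) simp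
    finally show "sqrt (norm (?h x))
        \<le> (\<Sum>l<M N. sqrt (norm (?g (?e l))) * sqrt (norm (?k l x))) / sqrt (M N)"
      by (simp add: norm_mult real_sqrt_mult)
  qed
  also have "\<dots> = (\<Sum>l<M N. sqrt (norm (?g (?e l))) * (\<integral>x. sqrt (norm (?k l x)) \<partial>\<mu>)) / sqrt (M N)"
    using integrable_sqrt_norm[OF cyl] by simp
  also have "\<dots> = (\<Sum>l<M N. sqrt (norm (?g (?e l))) * Lhalf (fejer n)) / sqrt (M N)"
    unfolding Lhalf_def
    by (subst integral_vadd[OF cylindrical_sqrt_norm[OF cylindrical_fejer[OF n]]]) auto
  also have "\<dots> = sqrt (M N) * Lhalf (fejer n) * ((\<Sum>l<M N. sqrt (norm (?g (?e l)))) /\<^sub>R real (M N))"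
  proof -
    \<comment> \<open>Subadditivity leaves only \<open>1 / sqrt (M N)\<close> of the averaging
      factor; restoring the full average, which is an integral again, costs
      \<open>sqrt (M N)\<close>.\<close>
    have "s / sqrt (M N) = sqrt (M N) * (s / M N)" for s
      using M_pos[of N] by (simp add: field_simps)
    then show ?thesis
      unfolding sum_distrib_right[symmetric] by (simp add: divide_inverse mult_ac)
  qed
  also have "(\<Sum>l<M N. sqrt (norm (?g (?e l)))) /\<^sub>R real (M N) = Lhalf ?g"
    unfolding Lhalf_def
    by (rule integral_cylindrical[symmetric])
      (rule cylindrical_sqrt_norm[OF cylindrical_partial_series])
  finally show ?thesis .
qed

lemma M_power_le: "i \<le> N \<Longrightarrow> 2 ^ (N - i) * M i \<le> M N"
proof (induction N rule: dec_induct)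
  case (step n)
  then show ?case using M_double[of n] by (simp add: Suc_diff_le del: vM.simps)
qed simp

text \<open>The multiplier estimate is applied at level \<open>Suc i\<close> to the coefficients cut
  off below \<open>M i\<close>; there \<open>Lhalf_fejer_le\<close> gives the factor
  \<open>i + 2\<close>.\<close>

lemma Lhalf_fejer_block:
  assumes "n \<le> M (Suc i)"
  shows "Lhalf (block (\<lambda>j. of_nat (n - j) * c j) i)
    \<le> sqrt (M (Suc i)) * (real (i + 2) * (5 * (real B)\<^sup>2)) * Lhalf (block c i)"
proof -
  let ?t = "\<lambda>j. if j < M i then 0 else c j"
  have "block (\<lambda>j. of_nat (n - j) * c j) i
      = (\<lambda>x. \<Sum>j<M (Suc i). of_nat (n - j) * ?t j * \<psi> j x)"
    unfolding partial_series_tail[symmetric] partial_series_def[abs_def]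
    by (intro ext sum.cong) auto
  then have "Lhalf (block (\<lambda>j. of_nat (n - j) * c j) i)
      \<le> sqrt (M (Suc i)) * Lhalf (fejer n) * Lhalf (partial_series ?t (Suc i))"
    using Lhalf_fejer_multiplier[OF assms, of ?t] by simp
  also have "partial_series ?t (Suc i) = block c i"
    by (rule ext) (rule partial_series_tail)
  also have "sqrt (M (Suc i)) * Lhalf (fejer n) * Lhalf (block c i)
      \<le> sqrt (M (Suc i)) * (real (i + 2) * (5 * (real B)\<^sup>2)) * Lhalf (block c i)"
    using Lhalf_fejer_le[OF assms] by (intro mult_right_mono mult_left_mono Lhalf_nonneg) auto
  finally show ?thesis .
qed

lemma block_cmult: "block (\<lambda>j. a * c j) i = (\<lambda>x. a * block c i x)"
  by (simp add: block_def[abs_def] sum_distrib_left mult.assoc)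

lemma block_diff: "block (\<lambda>j. c j - d j) i = (\<lambda>x. block c i x - block d i x)"
  by (simp add: block_def[abs_def] left_diff_distrib sum_subtractf)

lemma block_cong: "(\<And>j. M i \<le> j \<Longrightarrow> j < M (Suc i) \<Longrightarrow> c j = d j) \<Longrightarrow> block c i = block d i"
  unfolding block_def[abs_def] by (intro ext sum.cong) auto

text \<open>
  On the blocks strictly below \<open>n\<close> the error multiplier is \<open>-j/n\<close>, which is rewritten with
  the Fejer mean of order \<open>M (Suc i)\<close> of the same block: the factor \<open>M (Suc i) / n\<close> decays
  geometrically.
\<close>

lemma Lhalf_fejer_error_block:
  assumes "M (Suc i) \<le> n"
  shows "Lhalf (block (fejer_error c n) i)
    \<le> sqrt (M (Suc i) / n) * (real (i + 2) * (5 * (real B)\<^sup>2 + 1)) * Lhalf (block c i)"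
proof -
  let ?M = "M (Suc i)"
  have n: "0 < n" using assms M_pos[of "Suc i"] by linarith
  let ?a = "\<lambda>x. block (\<lambda>j. of_nat (?M - j) * c j) i x" and ?b = "\<lambda>x. of_nat ?M * block c i x"
  have "block (fejer_error c n) i = block (\<lambda>j. 1 / of_nat n * (of_nat (?M - j) * c j - of_nat ?M * c j)) i"
  proof (rule block_cong)
    fix j assume "M i \<le> j" "j < ?M"
    then show "fejer_error c n j = 1 / of_nat n * (of_nat (?M - j) * c j - of_nat ?M * c j)"
      using n assms by (simp add: fejer_error_def of_nat_diff divide_simps del: vM.simps)
        (simp add: algebra_simps)
  qed
  also have "\<dots> = (\<lambda>x. 1 / of_nat n * (?a x - ?b x))"
    unfolding block_cmult block_diff ..
  finally have err: "Lhalf (block (fejer_error c n) i) = sqrt (1 / n) * Lhalf (\<lambda>x. ?a x - ?b x)"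
    by (simp only: Lhalf_cmult) (simp add: norm_divide)
  have "Lhalf ?b = sqrt ?M * Lhalf (block c i)"
    by (simp only: Lhalf_cmult norm_of_nat)
  also have "\<dots> \<le> sqrt ?M * (real (i + 2) * Lhalf (block c i))"
    using mult_right_mono[of 1 "real (i + 2)" "Lhalf (block c i)"] Lhalf_nonneg
    by (intro mult_left_mono) auto
  finally have b: "Lhalf ?b \<le> sqrt ?M * (real (i + 2) * Lhalf (block c i))" .
  have "Lhalf (\<lambda>x. ?a x - ?b x) \<le> Lhalf ?a + Lhalf ?b"
    by (rule Lhalf_diff[OF cylindrical_block cylindrical_comp[OF cylindrical_block]])
  also have "\<dots> \<le> sqrt ?M * (real (i + 2) * (5 * (real B)\<^sup>2)) * Lhalf (block c i)
      + sqrt ?M * (real (i + 2) * Lhalf (block c i))"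
    by (intro add_mono b Lhalf_fejer_block order_refl)
  also have "\<dots> = sqrt ?M * (real (i + 2) * (5 * (real B)\<^sup>2 + 1)) * Lhalf (block c i)"
    by (simp only: distrib_left distrib_right mult.assoc mult_1_right mult_1_left)
  finally have "sqrt (1 / n) * Lhalf (\<lambda>x. ?a x - ?b x)
      \<le> sqrt (1 / n) * (sqrt ?M * (real (i + 2) * (5 * (real B)\<^sup>2 + 1)) * Lhalf (block c i))"
    by (rule mult_left_mono) simp
  then show ?thesis
    unfolding err real_sqrt_divide by (simp only: mult.assoc real_sqrt_one times_divide_eq_left mult_1_left)
qed

text \<open>This serves the block containing \<open>n\<close>. The constant is enlarged by 1 to
  agree with that of the earlier blocks.\<close>

lemma Lhalf_fejer_mean_block:
  assumes "0 < n" "n \<le> M (Suc i)"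
  shows "Lhalf (block (\<lambda>j. of_nat (n - j) / of_nat n * c j) i)
    \<le> sqrt (M (Suc i) / n) * (real (i + 2) * (5 * (real B)\<^sup>2 + 1)) * Lhalf (block c i)"
proof -
  have "block (\<lambda>j. of_nat (n - j) / of_nat n * c j) i
      = (\<lambda>x. 1 / of_nat n * block (\<lambda>j. of_nat (n - j) * c j) i x)"
    using block_cmult[of "1 / of_nat n" "\<lambda>j. of_nat (n - j) * c j" i] by (simp add: mult_ac)
  then have "Lhalf (block (\<lambda>j. of_nat (n - j) / of_nat n * c j) i)
      = sqrt (1 / n) * Lhalf (block (\<lambda>j. of_nat (n - j) * c j) i)"
    using Lhalf_cmult[of "1 / of_nat n" "block (\<lambda>j. of_nat (n - j) * c j) i"]
    by (simp add: norm_divide)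
  also have "\<dots> \<le> sqrt (1 / n) * (sqrt (M (Suc i)) * (real (i + 2) * (5 * (real B)\<^sup>2)) * Lhalf (block c i))"
    by (intro mult_left_mono Lhalf_fejer_block assms) simp
  also have "\<dots> = sqrt (M (Suc i) / n) * (real (i + 2) * (5 * (real B)\<^sup>2)) * Lhalf (block c i)"
    by (simp add: real_sqrt_divide mult_ac del: vM.simps)
  also have "\<dots> \<le> sqrt (M (Suc i) / n) * (real (i + 2) * (5 * (real B)\<^sup>2 + 1)) * Lhalf (block c i)"
    by (intro mult_right_mono mult_left_mono Lhalf_nonneg) auto
  finally show ?thesis .
qed

text \<open>\<open>M (Suc i) \<le> B * M i\<close>, and \<open>M\<close> at least doubles at each of
  the \<open>N - i\<close> steps from \<open>i\<close> to \<open>N\<close>.\<close>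

lemma sqrt_M_ratio_le:
  assumes "i \<le> N" "M N \<le> n"
  shows "sqrt (M (Suc i) / n) \<le> sqrt B * (1 / sqrt 2) ^ (N - i)"
proof -
  have "2 ^ (N - i) * M (Suc i) \<le> B * n"
  proof -
    have "2 ^ (N - i) * M (Suc i) = m i * (2 ^ (N - i) * M i)" by simp
    also have "\<dots> \<le> B * n"
      using M_power_le[OF assms(1)] assms(2) le_B[of i] by (intro mult_mono) auto
    finally show ?thesis .
  qed
  then have "real (2 ^ (N - i) * M (Suc i)) \<le> real (B * n)"
    by (simp only: of_nat_le_iff)
  moreover have "0 < n" using assms(2) M_pos[of N] by linarith
  ultimately have "M (Suc i) / n \<le> B * (1 / 2) ^ (N - i)"
    by (simp add: divide_simps mult_ac del: vM.simps)
  then have "sqrt (M (Suc i) / n) \<le> sqrt (B * (1 / 2) ^ (N - i))"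
    by (rule real_sqrt_le_mono)
  then show ?thesis
    by (simp add: real_sqrt_mult real_sqrt_power real_sqrt_divide)
qed

lemma max_root_uminus: "max_root (\<lambda>j. - c j) = max_root c"
  by (simp add: max_root_def partial_series_def sum_negf)

text \<open>The error is \<open>d\<close> minus the tail of the series from \<open>M N\<close> on.
  Here \<open>d\<close> is the error on the blocks before \<open>N\<close>, the Fejer mean on block
  \<open>N\<close>, and zero afterwards, so it is summed block by block.\<close>

lemma max_root_fejer_error_le:
  assumes n: "M N \<le> n" "n < M (Suc N)"
  shows "max_root (fejer_error c n)
    \<le> ennreal (sqrt B * (5 * (real B)\<^sup>2 + 1) *
        (\<Sum>i\<le>N. (1 / sqrt 2) ^ (N - i) * (real (i + 2) * Lhalf (block c i))))
      + max_root (\<lambda>j. if j < M N then 0 else c j)"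
proof -
  define d where "d = (\<lambda>j. if j < M N then fejer_error c n j else of_nat (n - j) / of_nat n * c j)"
  let ?t = "\<lambda>j. if j < M N then 0 else c j"
  let ?K = "5 * (real B)\<^sup>2 + 1"
  have n0: "0 < n" using n(1) M_pos[of N] by linarith
  have "fejer_error c n = (\<lambda>j. d j + - ?t j)"
    by (auto simp: d_def fejer_error_def algebra_simps)
  then have "max_root (fejer_error c n) \<le> max_root d + max_root ?t"
    using max_root_add[of d "\<lambda>j. - ?t j"] max_root_uminus[of ?t] by simp
  also have "max_root d \<le> (\<Sum>i. ennreal (Lhalf (block d i)))"
    \<comment> \<open>At \<open>j = 0\<close> the error multiplier \<open>n / n - 1\<close>
      vanishes, so \<open>d\<close> has no constant term.\<close>
    using M_pos[of N] n0 by (intro max_root_le_blocks) (simp add: d_def fejer_error_def)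
  also have "\<dots> = (\<Sum>i\<le>N. ennreal (Lhalf (block d i)))"
  proof (rule suminf_finite)
    fix i assume "i \<notin> {..N}"
    then have "M (Suc N) \<le> M i" "M N \<le> M i"
      using M_mono[of "Suc N" i] M_mono[of N i] by auto
    then have "block d i = block (\<lambda>j. 0) i"
      using n by (intro block_cong) (auto simp: d_def)
    then show "ennreal (Lhalf (block d i)) = 0"
      by (simp add: block_def[abs_def] Lhalf_def)
  qed simp
  also have "\<dots> \<le> (\<Sum>i\<le>N. ennreal (sqrt B * (1 / sqrt 2) ^ (N - i) * (real (i + 2) * ?K) * Lhalf (block c i)))"
  proof (intro sum_mono ennreal_leI)
    fix i assume "i \<in> {..N}"
    then have i: "i \<le> N" by simp
    have "Lhalf (block d i) \<le> sqrt (M (Suc i) / n) * (real (i + 2) * ?K) * Lhalf (block c i)"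
    proof (cases "i = N")
      case True
      then have "block d i = block (\<lambda>j. of_nat (n - j) / of_nat n * c j) i"
        by (intro block_cong) (auto simp: d_def)
      then show ?thesis using Lhalf_fejer_mean_block[of n i c] n n0 True by simp
    next
      case False
      then have M: "M (Suc i) \<le> M N" using i by (intro M_mono) simp
      then have "block d i = block (fejer_error c n) i"
        by (intro block_cong) (auto simp: d_def)
      then show ?thesis using Lhalf_fejer_error_block[of i n c] M n by simp
    qed
    also have "\<dots> \<le> sqrt B * (1 / sqrt 2) ^ (N - i) * (real (i + 2) * ?K) * Lhalf (block c i)"
      by (intro mult_right_mono sqrt_M_ratio_le i n Lhalf_nonneg) auto
    finally show "Lhalf (block d i) \<le> sqrt B * (1 / sqrt 2) ^ (N - i) * (real (i + 2) * ?K) * Lhalf (block c i)" .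
  qed
  also have "\<dots> = ennreal (\<Sum>i\<le>N. sqrt B * (1 / sqrt 2) ^ (N - i) * (real (i + 2) * ?K) * Lhalf (block c i))"
    by (intro sum_ennreal mult_nonneg_nonneg Lhalf_nonneg) auto
  also have "(\<Sum>i\<le>N. sqrt B * (1 / sqrt 2) ^ (N - i) * (real (i + 2) * ?K) * Lhalf (block c i))
      = sqrt B * ?K * (\<Sum>i\<le>N. (1 / sqrt 2) ^ (N - i) * (real (i + 2) * Lhalf (block c i)))"
    unfolding sum_distrib_left by (intro sum.cong) (auto simp: mult_ac)
  finally show ?thesis by (simp add: add_right_mono)
qed

text \<open>For \<open>n > 0\<close> this is the index of the frequency block containing
  \<open>n\<close>; \<open>level 0\<close> is 0.\<close>

definition level :: "nat \<Rightarrow> nat" where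
  "level n = (LEAST N. n < M (Suc N))"

lemma level_upper: "n < M (Suc (level n))"
  unfolding level_def by (rule LeastI[of _ n]) (rule less_trans[OF less_M], rule M_strict, simp)

lemma level_lower: "0 < n \<Longrightarrow> M (level n) \<le> n"
proof (cases "level n")
  case (Suc k)
  then have "\<not> n < M (Suc k)" unfolding level_def by (intro not_less_Least) simp
  then show ?thesis using Suc by simp
qed simp

lemma level_eq: "M i \<le> n \<Longrightarrow> n < M (Suc i) \<Longrightarrow> level n = i"
  unfolding level_def
proof (rule Least_equality)
  fix k assume "M i \<le> n" "n < M (Suc k)"
  then have "M i < M (Suc k)" by linarith
  then show "i \<le> k" using M_mono[of "Suc k" i] by (meson not_less not_less_eq_eq)
qed

lemma filterlim_level: "filterlim level at_top at_top"
  unfolding filterlim_at_top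
proof
  fix K
  show "\<forall>\<^sub>F n in at_top. K \<le> level n"
    using eventually_ge_at_top[of "M K"]
  proof eventually_elim
    case (elim n)
    then have "M K < M (Suc (level n))" using level_upper[of n] by linarith
    then show ?case using M_mono[of "Suc (level n)" K] by (meson not_less not_less_eq_eq)
  qed
qed

text \<open>After taking roots the assumption says that the tails \<open>w n\<close> are o(1/n).
  This absorbs the factor \<open>i + 2\<close> on each block, and the convolution with a geometric
  sequence preserves convergence to 0.\<close>

theorem fejer_means_converge:
  assumes f: "f \<in> Hp_space m (1/2)"
    and modulus: "\<And>c. 0 < c \<Longrightarrow>
      \<forall>\<^sub>F n in sequentially. Hp_modulus m (1/2) n f \<le> ennreal (c / real n ^ 2)"
  shows "(\<lambda>n. Hp_norm m (1/2) (mart_diff (mart_of m (fejer_mean m n f)) f)) \<longlonglongrightarrow> 0"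
proof -
  define c where "c = mart_coeff m f"
  have mart: "vmartingale m f" using f by (simp add: Hp_space_def)
  define w where "w = (\<lambda>n. max_root (\<lambda>j. if j < M n then 0 else c j))"
  have w: "Hp_modulus m (1/2) n f = w n * w n" for n
    unfolding Hp_modulus_def w_def c_def
    by (intro Hp_norm_eq modulus_eq_partial_series mart)
  have w_le: "\<forall>\<^sub>F n in sequentially. w n \<le> ennreal (e / real n)" if e: "0 < e" for e
    using modulus[OF zero_less_power[OF e, of 2]]
  proof eventually_elim
    case (elim n)
    have "ennreal (e / n) * ennreal (e / n) = ennreal (e\<^sup>2 / (real n)\<^sup>2)"
      using e by (simp add: ennreal_mult[symmetric] power2_eq_square)
    with elim(1) have "w n * w n \<le> ennreal (e / n) * ennreal (e / n)"
      by (simp only: w)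
    then show ?case by (simp only: ennreal_mult_self_le_iff)
  qed
  let ?b = "\<lambda>i. real (i + 2) * Lhalf (block c i)"
  have b: "?b \<longlonglongrightarrow> 0"
  proof (rule LIMSEQ_I)
    fix r :: real assume r: "0 < r"
    \<comment> \<open>For \<open>n \<ge> 2\<close> one has \<open>(n + 2) / n \<le> 2\<close>, so
      \<open>r / 4\<close> leads to at most \<open>r / 2\<close>.\<close>
    then have r4: "0 < r / 4" by simp
    have "\<forall>\<^sub>F n in sequentially. norm (?b n - 0) < r"
      using w_le[OF r4] eventually_ge_at_top[of 2]
    proof eventually_elim
      case (elim n)
      have "ennreal (Lhalf (block c n)) \<le> w n"
        unfolding w_def by (rule Lhalf_block_le_tail)
      also note elim(1)
      finally have "Lhalf (block c n) \<le> r / 4 / n"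
        using r by (simp add: ennreal_le_iff)
      then have "?b n \<le> real (n + 2) * (r / 4 / n)"
        by (intro mult_left_mono) auto
      also have "\<dots> < r"
        using r elim(2) by (simp add: field_simps)
      finally show ?case using Lhalf_nonneg[of "block c n"] by simp
    qed
    then show "\<exists>n0. \<forall>n\<ge>n0. norm (?b n - 0) < r"
      by (simp add: eventually_sequentially)
  qed
  have w0: "w \<longlonglongrightarrow> 0"
  proof (rule tendsto_sandwich[of "\<lambda>_. 0"])
    show "\<forall>\<^sub>F n in sequentially. w n \<le> ennreal (1 / real n)"
      using w_le[of 1] by simp
    have "(\<lambda>n. ennreal (1 / real n)) \<longlonglongrightarrow> ennreal 0"
      by (intro tendsto_ennrealI lim_1_over_n)
    then show "(\<lambda>n. ennreal (1 / real n)) \<longlonglongrightarrow> 0" by simp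
  qed auto
  define E where "E = (\<lambda>N. ennreal (sqrt B * (5 * (real B)\<^sup>2 + 1) *
        (\<Sum>i\<le>N. (1 / sqrt 2) ^ (N - i) * ?b i)) + w N)"
  have "(\<lambda>N. \<Sum>i\<le>N. (1 / sqrt 2) ^ (N - i) * ?b i) \<longlonglongrightarrow> 0"
    by (rule tendsto_geometric_convolution_0[OF b]) auto
  then have "(\<lambda>N. ennreal (sqrt B * (5 * (real B)\<^sup>2 + 1) *
      (\<Sum>i\<le>N. (1 / sqrt 2) ^ (N - i) * ?b i))) \<longlonglongrightarrow> ennreal 0"
    by (intro tendsto_ennrealI tendsto_mult_right_zero)
  then have "E \<longlonglongrightarrow> 0 + 0"
    unfolding E_def by (intro tendsto_add w0) simp
  then have E0: "(\<lambda>n. E (level n)) \<longlonglongrightarrow> 0"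
    using filterlim_compose[OF _ filterlim_level, of E "nhds 0"] by simp
  have le: "\<forall>\<^sub>F n in sequentially. max_root (fejer_error c n) \<le> E (level n)"
    using eventually_gt_at_top[of 0]
    unfolding E_def w_def
    by eventually_elim (intro max_root_fejer_error_le level_lower level_upper)
  \<comment> \<open>The quasi-norm is the square of \<open>max_root\<close>; once \<open>E\<close>
    is below 1, the square is at most \<open>E\<close> itself.\<close>
  have "\<forall>\<^sub>F n in sequentially. E (level n) < 1"
    using order_tendstoD(2)[OF E0, of 1] by simp
  then have "\<forall>\<^sub>F n in sequentially.
      Hp_norm m (1/2) (mart_diff (mart_of m (fejer_mean m n f)) f) \<le> E (level n)"
    using le
  proof eventually_elim
    case (elim n)
    have "Hp_norm m (1/2) (mart_diff (mart_of m (fejer_mean m n f)) f)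
        = max_root (fejer_error c n) * max_root (fejer_error c n)"
      unfolding c_def by (intro Hp_norm_eq fejer_error_eq_partial_series mart)
    also have "\<dots> \<le> E (level n) * 1"
      using elim by (intro mult_mono) auto
    finally show ?case by simp
  qed
  then show ?thesis
    by (intro tendsto_sandwich[OF _ _ tendsto_const E0]) auto
qed

section \<open>Lower bound for the Fejer kernels\<close>

text \<open>The spacing leaves room for nonzero coordinates at \<open>2 * i\<close> and
  \<open>2 * i + 1\<close> before the next nonzero digit at \<open>2 * i + 2\<close>, as
  \<open>fejer_M_eq_0\<close> requires.\<close>

definition even_index :: "nat \<Rightarrow> nat" where
  "even_index h = (\<Sum>i<h. M (2 * i))"

lemma even_index_less: "even_index h < M (2 * h)"
proof (induction h)
  case (Suc h)
  have "M (2 * h) + M (2 * h) \<le> M (Suc (2 * h))"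
    using M_double[of "2 * h"] by (simp del: vM.simps)
  also have "\<dots> \<le> M (2 * Suc h)" by (rule M_mono) simp
  finally show ?case using Suc by (simp add: even_index_def del: vM.simps)
qed (simp add: even_index_def)

lemma fejer_even_index_Suc:
  "fejer (even_index (Suc h)) x = fejer (M (2 * h)) x
    + of_nat (even_index h) * dirichlet (M (2 * h)) x + rad (2 * h) x * fejer (even_index h) x"
  using fejer_block[of "even_index h" "2 * h" 1 x] even_index_less[of h] two_le[of "2 * h"]
  by (simp add: even_index_def add.commute)

text \<open>Above position \<open>s\<close> the Dirichlet kernels vanish, so each step from
  \<open>A\<close> to \<open>Suc A\<close> just multiplies by the sum of powers of
  \<open>rad A x\<close>. At \<open>A = Suc s\<close> that sum is 0.\<close>

lemma fejer_M_eq_0: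
  assumes x: "x \<in> G" "x s \<noteq> 0" "x (Suc s) \<noteq> 0" and A: "s + 2 \<le> A"
  shows "fejer (M A) x = 0"
proof -
  have D: "dirichlet (j * M A) x = 0" if "Suc s \<le> A" "j \<le> m A" for A j
    using that x by (auto simp: dirichlet_multiple dirichlet_M intro!: exI[of _ s])
  have step: "fejer (M (Suc A)) x = (\<Sum>j<m A. rad A x ^ j) * fejer (M A) x" if "Suc s \<le> A" for A
    using fejer_multiple[of "m A" A x] that by (simp add: D)
  show ?thesis using A
  proof (induction A rule: dec_induct)
    case base
    show ?case using step[of "Suc s"] x sum_rad[OF x(1), of "Suc s"] by simp
  next
    case (step n)
    then show ?case using \<open>\<And>A. Suc s \<le> A \<Longrightarrow> fejer (M (Suc A)) x = _ A\<close>[of n] by simp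
  qed
qed

text \<open>All characters of index below \<open>M (2 * i)\<close> are 1 at \<open>x\<close>, so the
  kernels up to this order are explicit. With \<open>r = even_index i\<close> the only term of
  unknown phase is \<open>r * (r + 1) / 2\<close>, and \<open>r * M (2 * i)\<close> outweighs
  it.\<close>

lemma norm_fejer_even_index:
  assumes x: "x \<in> G" "\<And>k. k < 2 * i \<Longrightarrow> x k = 0" "x (2 * i) \<noteq> 0" "x (Suc (2 * i)) \<noteq> 0"
    and h: "i < h"
  shows "(real (M (2 * i)))\<^sup>2 / 2 \<le> norm (fejer (even_index h) x)"
proof -
  let ?M = "M (2 * i)" and ?r = "even_index i"
  have \<psi>: "\<psi> j x = 1" if "j < ?M" for j
    unfolding vilenkin_prod[OF that] using x(2) by (intro prod.neutral) (simp add: vrademacher_def)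
  have D: "dirichlet n x = of_nat n" if "n \<le> ?M" for n
    unfolding dirichlet_def using that \<psi> by simp
  have F: "fejer n x = of_nat (n * (n + 1)) / 2" if "n \<le> ?M" for n
    using that
  proof (induction n)
    case (Suc n)
    then show ?case by (simp add: fejer_Suc D field_simps)
  qed simp
  have r: "?r + 1 \<le> ?M" using even_index_less[of i] by simp
  have "real ?r * (real ?r + 1) \<le> real ?r * real ?M"
    using r by (intro mult_left_mono) linarith+
  moreover have "0 \<le> real ?r * real ?M" "0 \<le> real ?M" by simp_all
  moreover have "real (?M * (?M + 1)) / 2 = (real ?M)\<^sup>2 / 2 + real ?M / 2"
    "real (?r * (?r + 1)) = real ?r * (real ?r + 1)"
    by (simp_all add: power2_eq_square add_divide_distrib distrib_left)
  ultimately have "(real ?M)\<^sup>2 / 2 \<le> real (?M * (?M + 1)) / 2 + real ?r * real ?M - real (?r * (?r + 1)) / 2"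
    by linarith
  also have "\<dots> = norm (of_nat (?M * (?M + 1)) / 2 + of_nat ?r * of_nat ?M :: complex)
      - norm (rad (2 * i) x * (of_nat (?r * (?r + 1)) / 2))"
  proof -
    have "(of_nat (?M * (?M + 1)) / 2 + of_nat ?r * of_nat ?M :: complex)
        = of_real (real (?M * (?M + 1)) / 2 + real ?r * real ?M)" by simp
    then have "norm (of_nat (?M * (?M + 1)) / 2 + of_nat ?r * of_nat ?M :: complex)
        = real (?M * (?M + 1)) / 2 + real ?r * real ?M" by (simp only: norm_of_real) simp
    moreover have "norm (rad (2 * i) x * (of_nat (?r * (?r + 1)) / 2)) = real (?r * (?r + 1)) / 2"
      by (simp only: norm_mult norm_divide norm_of_nat norm_rad) simp
    ultimately show ?thesis by simp
  qed
  also have "\<dots> \<le> norm (of_nat (?M * (?M + 1)) / 2 + of_nat ?r * of_nat ?M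
      + rad (2 * i) x * (of_nat (?r * (?r + 1)) / 2))"
    by (rule norm_diff_ineq)
  also have "\<dots> = norm (fejer (even_index (Suc i)) x)"
    unfolding fejer_even_index_Suc using r by (simp only: F D add_leD1 order_refl)
  \<comment> \<open>Each further digit only multiplies the kernel by the unimodular
    \<open>rad (2 * n) x\<close>.\<close>
  also have "\<dots> = norm (fejer (even_index h) x)"
    using Suc_leI[OF h]
  proof (induction h rule: dec_induct)
    case (step n)
    then have "fejer (M (2 * n)) x = 0"
      using x by (intro fejer_M_eq_0[of x "2 * i"]) auto
    moreover have "dirichlet (M (2 * n)) x = 0"
      using step x by (auto simp: dirichlet_M intro!: exI[of _ "2 * i"])
    ultimately show ?case
      using step by (simp add: fejer_even_index_Suc norm_mult)
  qed simp
  finally show ?thesis .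
qed

text \<open>The sets \<open>?E i\<close> are disjoint, as the first nonzero coordinate is at
  \<open>2 * i\<close>. On \<open>?E i\<close>, of measure at least
  \<open>1 / (B ^ 2 * M (2 * i))\<close>, the root of the kernel is at least
  \<open>M (2 * i) / sqrt 2\<close>; the product does not depend on \<open>i\<close>.\<close>

lemma Lhalf_fejer_even_index: "real h / (sqrt 2 * (real B)\<^sup>2) \<le> Lhalf (fejer (even_index h))"
proof -
  define p where "p = (\<lambda>i k. if k = 2 * i \<or> k = Suc (2 * i) then 1 else 0 :: nat)"
  let ?E = "\<lambda>i. vinterval m (2 * i + 2) (p i)"
  have p: "p i \<in> G" for i
    using two_le[of "2 * i"] two_le[of "Suc (2 * i)"] by (auto simp: p_def vgroup_def m_pos)
  have E: "x \<in> G" "\<And>k. k < 2 * i \<Longrightarrow> x k = 0" "x (2 * i) = 1" "x (Suc (2 * i)) = 1"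
    if "x \<in> ?E i" for x i
    using that by (auto simp: vinterval_def p_def)
  have meas: "measure \<mu> (?E i) \<ge> 1 / ((real B)\<^sup>2 * real (M (2 * i)))" for i
  proof -
    have "real (m (Suc (2 * i)) * (m (2 * i) * M (2 * i))) \<le> real (B * (B * M (2 * i)))"
      unfolding of_nat_le_iff by (intro mult_mono le_B) auto
    then have "real (M (2 * i + 2)) \<le> (real B)\<^sup>2 * real (M (2 * i))"
      by (simp add: power2_eq_square mult.assoc)
    then show ?thesis
      unfolding measure_vinterval[OF p] using M_pos[of "2 * i + 2"] by (intro frac_le) simp_all
  qed
  have disj: "i = j" if "x \<in> ?E i" "x \<in> ?E j" for x i j
    using E(2)[OF that(1), of "2 * j"] E(2)[OF that(2), of "2 * i"] E(3)[OF that(1)] E(3)[OF that(2)]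
    by (cases i j rule: linorder_cases) auto
  have pt: "(\<Sum>i<h. real (M (2 * i)) / sqrt 2 * indicator (?E i) x) \<le> sqrt (norm (fejer (even_index h) x))"
    for x
  proof (cases "\<exists>i<h. x \<in> ?E i")
    case True
    then obtain i where i: "i < h" "x \<in> ?E i" by blast
    have "(\<Sum>j<h. real (M (2 * j)) / sqrt 2 * indicator (?E j) x)
        = (\<Sum>j<h. if j = i then real (M (2 * i)) / sqrt 2 else 0)"
    proof (rule sum.cong[OF refl])
      fix j
      show "real (M (2 * j)) / sqrt 2 * indicator (?E j) x = (if j = i then real (M (2 * i)) / sqrt 2 else 0)"
      proof (cases "j = i")
        case False
        then have "x \<notin> ?E j" using disj[OF i(2)] by blast
        then show ?thesis using False by simp
      qed (use i(2) in simp)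
    qed
    also have "\<dots> = real (M (2 * i)) / sqrt 2"
      using i by simp
    also have "\<dots> = sqrt ((real (M (2 * i)))\<^sup>2 / 2)"
      by (simp add: real_sqrt_divide)
    also have "\<dots> \<le> sqrt (norm (fejer (even_index h) x))"
      using E[OF i(2)] i(1) by (intro real_sqrt_le_mono norm_fejer_even_index) auto
    finally show ?thesis .
  next
    case False
    then have "(\<Sum>i<h. real (M (2 * i)) / sqrt 2 * indicator (?E i) x) = 0"
      by (intro sum.neutral) auto
    then show ?thesis by simp
  qed
  have int: "integrable \<mu> (\<lambda>x. a * indicator (?E i) x :: real)" for a i
    by (intro integrable_mult_right integrable_real_indicator vinterval_sets)
      (simp add: emeasure_eq_measure)
  have "real h / (sqrt 2 * (real B)\<^sup>2) = (\<Sum>i<h. real (M (2 * i)) / sqrt 2 * (1 / ((real B)\<^sup>2 * real (M (2 * i)))))"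
    by (simp add: field_simps less_imp_neq[OF M_pos, symmetric])
  also have "\<dots> \<le> (\<Sum>i<h. real (M (2 * i)) / sqrt 2 * measure \<mu> (?E i))"
    by (intro sum_mono mult_left_mono meas) simp
  also have "\<dots> = (\<Sum>i<h. \<integral>x. real (M (2 * i)) / sqrt 2 * indicator (?E i) x \<partial>\<mu>)"
    by (intro sum.cong refl, subst integral_mult_right_zero)
      (simp add: Int_absorb2[OF sets.sets_into_space[OF vinterval_sets], simplified])
  also have "\<dots> = (\<integral>x. (\<Sum>i<h. real (M (2 * i)) / sqrt 2 * indicator (?E i) x) \<partial>\<mu>)"
    by (rule Bochner_Integration.integral_sum[symmetric]) (rule int)
  also have "\<dots> \<le> Lhalf (fejer (even_index h))"
    unfolding Lhalf_def using even_index_less[of h]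
    by (intro integral_mono pt integrable_sqrt_norm[OF cylindrical_fejer[of _ "2 * h"]]
        Bochner_Integration.integrable_sum int) simp
  finally show ?thesis .
qed

section \<open>The lacunary counterexample\<close>

text \<open>The height \<open>M N / N ^ 2\<close> gives the block \<open>N\<close> size O(1/N) under
  \<open>Lhalf\<close>, the critical rate. Using only powers of two keeps the sum over the tail of
  the same order.\<close>

definition lacunary_coeff :: "nat \<Rightarrow> complex" where
  "lacunary_coeff j = (if level j \<in> range (\<lambda>k. 2 ^ k)
     then of_real (real (M (level j)) / (real (level j))\<^sup>2) else 0)"

lemma block_lacunary:
  "block lacunary_coeff i x = (if i \<in> range (\<lambda>k. 2 ^ k)
     then of_real (real (M i) / (real i)\<^sup>2) * (dirichlet (M (Suc i)) x - dirichlet (M i) x) else 0)"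
proof -
  have D: "dirichlet (M (Suc i)) x - dirichlet (M i) x = (\<Sum>j=M i..<M (Suc i). \<psi> j x)"
    using M_mono[of i "Suc i"]
    by (simp add: dirichlet_def lessThan_atLeast0 sum_diff_nat_ivl del: vM.simps)
  show ?thesis
    unfolding D block_def sum_distrib_left lacunary_coeff_def
    by (auto simp: level_eq sum_distrib_left simp del: vM.simps intro!: sum.neutral sum.cong)
qed

lemma Lhalf_block_lacunary_le:
  "Lhalf (block lacunary_coeff i) \<le> (if i \<in> range (\<lambda>k. 2 ^ k) then 2 / real i else 0)"
proof (cases "i \<in> range (\<lambda>k. 2 ^ k)")
  case True
  let ?D = "\<lambda>x. dirichlet (M (Suc i)) x - dirichlet (M i) x"
  have "Lhalf ?D \<le> Lhalf (dirichlet (M (Suc i))) + Lhalf (dirichlet (M i))"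
    by (intro Lhalf_diff[of "Suc i"] cylindrical_dirichlet M_mono) auto
  also have "\<dots> = 1 / sqrt (M (Suc i)) + 1 / sqrt (M i)"
    by (simp only: Lhalf_dirichlet_M)
  also have "1 / sqrt (M (Suc i)) \<le> 1 / sqrt (M i)"
    using M_pos[of i] M_pos[of "Suc i"] M_mono[of i "Suc i"] by (intro divide_left_mono) (auto simp del: vM.simps)
  finally have D: "Lhalf ?D \<le> 2 / sqrt (M i)" by simp
  have "block lacunary_coeff i = (\<lambda>x. of_real (real (M i) / (real i)\<^sup>2) * ?D x)"
    using True by (simp only: block_lacunary[abs_def] if_True)
  then have "Lhalf (block lacunary_coeff i) = sqrt (real (M i) / (real i)\<^sup>2) * Lhalf ?D"
    by (simp only: Lhalf_cmult norm_of_real) simp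
  also have "\<dots> \<le> sqrt (real (M i) / (real i)\<^sup>2) * (2 / sqrt (M i))"
    by (intro mult_left_mono D) simp
  also have "\<dots> = 2 / real i"
    using M_pos[of i] by (simp add: real_sqrt_divide)
  finally show ?thesis using True by simp
qed (simp add: block_lacunary[abs_def] Lhalf_def)

lemma lacunary_coeff_eq_0: "j < M 1 \<Longrightarrow> lacunary_coeff j = 0"
proof -
  assume "j < M 1"
  then have "level j = 0" by (simp add: level_def Least_eq_0)
  then show ?thesis by (auto simp: lacunary_coeff_def)
qed

text \<open>Only blocks \<open>2 ^ k \<ge> n\<close> count. If \<open>2 ^ l\<close> is the first
  such power, the geometric series of the \<open>2 / 2 ^ k\<close> adds up to
  \<open>4 / 2 ^ l\<close>.\<close>

lemma max_root_lacunary_tail_le: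
  assumes n: "0 < n"
  shows "max_root (\<lambda>j. if j < M n then 0 else lacunary_coeff j) \<le> ennreal (4 / real n)"
proof -
  let ?t = "\<lambda>j. if j < M n then 0 else lacunary_coeff j"
  define u where "u = (\<lambda>i. if n \<le> i \<and> i \<in> range (\<lambda>k. 2 ^ k) then 2 / real i else 0)"
  define v where "v = (\<lambda>k. if n \<le> 2 ^ k then 2 / 2 ^ k else 0 :: real)"
  have "Lhalf (block ?t i) \<le> u i" for i
  proof (cases "n \<le> i")
    case True
    then have "M n \<le> M i" by (rule M_mono)
    then have "block ?t i = block lacunary_coeff i"
      by (intro block_cong) auto
    then show ?thesis using Lhalf_block_lacunary_le[of i] True by (simp add: u_def)
  next
    case False
    then have "M (Suc i) \<le> M n" by (intro M_mono) simp
    then have "block ?t i = block (\<lambda>j. 0) i"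
      by (intro block_cong) auto
    then show ?thesis using False by (simp add: block_def[abs_def] Lhalf_def u_def)
  qed
  then have "max_root ?t \<le> (\<Sum>i. ennreal (u i))"
    using M_pos[of n] by (intro order_trans[OF max_root_le_blocks] suminf_le ennreal_leI) auto
  also have "\<dots> = (\<Sum>k. ennreal (u (2 ^ k)))"
    by (rule suminf_mono_reindex[symmetric]) (auto simp: strict_mono_def u_def)
  also have "\<dots> = (\<Sum>k. ennreal (v k))"
    by (intro arg_cong[where f = suminf] ext) (auto simp: u_def v_def)
  also have "\<dots> \<le> ennreal (4 / real n)"
  proof -
    define l where "l = (LEAST k. n \<le> 2 ^ k)"
    have l: "n \<le> 2 ^ l"
      unfolding l_def by (rule LeastI[of _ n]) (simp add: less_imp_le)
    have "(\<lambda>k. (2 / 2 ^ l) * (1 / 2) ^ k) sums ((2 / 2 ^ l) * (1 / (1 - 1 / 2 :: real)))"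
      by (intro sums_mult geometric_sums) simp
    also have "(\<lambda>k. (2 / 2 ^ l) * (1 / 2) ^ k) = (\<lambda>k. v (k + l))"
    proof
      fix k
      have "n \<le> 2 ^ (k + l)"
        using l by (rule order_trans) (simp add: power_increasing)
      then show "(2 / 2 ^ l) * (1 / 2) ^ k = v (k + l)"
        by (simp add: v_def power_add power_divide)
    qed
    finally have "v sums ((2 / 2 ^ l) * (1 / (1 - 1 / 2)))"
      by (subst (asm) sums_zero_iff_shift) (auto simp: v_def l_def dest: not_less_Least)
    then have "v sums (4 / 2 ^ l)" by simp
    then have "(\<Sum>k. ennreal (v k)) = ennreal (4 / 2 ^ l)"
      by (intro suminf_ennreal_eq) (auto simp: v_def)
    also have "\<dots> \<le> ennreal (4 / real n)"
    proof -
      have "real n \<le> 2 ^ l" using l by (metis of_nat_le_iff of_nat_numeral of_nat_power)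
      then show ?thesis using n by (intro ennreal_leI divide_left_mono) auto
    qed
    finally show ?thesis .
  qed
  finally show ?thesis .
qed

lemma max_root_lacunary_finite: "max_root lacunary_coeff < \<infinity>"
proof -
  have "lacunary_coeff j = (if j < M 1 then 0 else lacunary_coeff j)" for j
    using lacunary_coeff_eq_0[of j] by simp
  then have "max_root lacunary_coeff = max_root (\<lambda>j. if j < M 1 then 0 else lacunary_coeff j)"
    by (intro arg_cong[where f = max_root] ext)
  also have "\<dots> \<le> ennreal 4"
    using max_root_lacunary_tail_le[of 1] by simp
  finally show ?thesis by (simp add: le_less_trans)
qed

text \<open>The coefficients are constant on the block and
  \<open>q - (M N + r) = even_index (2 ^ k) - r\<close>, so the block of the Fejer mean is a
  multiple of \<open>rad N x * fejer (even_index (2 ^ k)) x\<close>. The lower bound for this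
  kernel, linear in \<open>2 ^ k = N / 2\<close>, cancels the factor \<open>1 / N\<close> from the
  coefficients.\<close>

lemma Lhalf_fejer_mean_lacunary_ge:
  assumes N: "N = 2 ^ Suc k" and q: "q = M N + even_index (2 ^ k)"
  shows "1 / (4 * (real B)\<^sup>2) \<le> Lhalf (block (\<lambda>j. of_nat (q - j) / of_nat q * lacunary_coeff j) N)"
proof -
  let ?Q = "even_index (2 ^ k)"
  have Q: "?Q < M N" using even_index_less[of "2 ^ k"] by (simp add: N)
  have q0: "0 < q" "q \<le> 2 * M N" using M_pos[of N] Q by (auto simp: q)
  have qM: "q \<le> M (Suc N)" using q0(2) M_double[of N] by linarith
  let ?a = "real (M N) / (real N)\<^sup>2 / real q"
  have "block (\<lambda>j. of_nat (q - j) / of_nat q * lacunary_coeff j) N x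
      = of_real ?a * (rad N x * fejer ?Q x)" for x
  proof -
    have "block (\<lambda>j. of_nat (q - j) / of_nat q * lacunary_coeff j) N x
        = (\<Sum>j=M N..<M (Suc N). of_real ?a * (of_nat (q - j) * \<psi> j x))"
      unfolding block_def
    proof (rule sum.cong[OF refl])
      fix j assume "j \<in> {M N..<M (Suc N)}"
      then have "level j = N" by (intro level_eq) auto
      moreover have "N \<in> range (\<lambda>k. 2 ^ k)" unfolding N by (rule rangeI)
      ultimately show "of_nat (q - j) / of_nat q * lacunary_coeff j * \<psi> j x
          = of_real ?a * (of_nat (q - j) * \<psi> j x)"
        by (simp add: lacunary_coeff_def mult_ac)
    qed
    also have "\<dots> = of_real ?a * (\<Sum>j=M N..<M (Suc N). of_nat (q - j) * \<psi> j x)"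
      by (simp only: sum_distrib_left)
    also have "(\<Sum>j=M N..<M (Suc N). of_nat (q - j) * \<psi> j x) = (\<Sum>j=M N..<q. of_nat (q - j) * \<psi> j x)"
      using qM by (intro sum.mono_neutral_right) auto
    also have "\<dots> = (\<Sum>r<?Q. of_nat (?Q - r) * \<psi> (1 * M N + r) x)"
      unfolding q by (rule sum.reindex_bij_witness[of _ "\<lambda>r. M N + r" "\<lambda>j. j - M N"]) auto
    also have "\<dots> = (\<Sum>r<?Q. rad N x * (of_nat (?Q - r) * \<psi> r x))"
      using Q two_le[of N] by (intro sum.cong refl, subst vilenkin_block) (auto simp: mult_ac)
    also have "\<dots> = rad N x * fejer ?Q x"
      by (simp only: fejer_eq sum_distrib_left)
    finally show ?thesis .
  qed
  then have "Lhalf (block (\<lambda>j. of_nat (q - j) / of_nat q * lacunary_coeff j) N)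
      = Lhalf (\<lambda>x. of_real ?a * (rad N x * fejer ?Q x))"
    by (intro arg_cong[where f = Lhalf] ext)
  also have "\<dots> = sqrt ?a * Lhalf (\<lambda>x. rad N x * fejer ?Q x)"
    by (simp only: Lhalf_cmult norm_of_real) simp
  also have "Lhalf (\<lambda>x. rad N x * fejer ?Q x) = Lhalf (fejer ?Q)"
    by (rule Lhalf_cong) (simp add: norm_mult)
  finally have eq: "Lhalf (block (\<lambda>j. of_nat (q - j) / of_nat q * lacunary_coeff j) N)
      = sqrt ?a * Lhalf (fejer ?Q)" .
  have N0: "0 < N" by (simp add: N)
  have "1 / (2 * (real N)\<^sup>2) \<le> ?a"
  proof -
    have "real q \<le> 2 * real (M N)" using q0(2) by (metis of_nat_le_iff of_nat_mult of_nat_numeral)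
    then show ?thesis using N0 q0(1) by (simp add: field_simps)
  qed
  then have "sqrt (1 / (2 * (real N)\<^sup>2)) \<le> sqrt ?a" by (rule real_sqrt_le_mono)
  then have "1 / (sqrt 2 * real N) \<le> sqrt ?a" by (simp add: real_sqrt_divide real_sqrt_mult)
  then have "1 / (sqrt 2 * real N) * (real (2 ^ k) / (sqrt 2 * (real B)\<^sup>2)) \<le> sqrt ?a * Lhalf (fejer ?Q)"
    using Lhalf_fejer_even_index[of "2 ^ k"] by (intro mult_mono) auto
  also have "1 / (sqrt 2 * real N) * (real (2 ^ k) / (sqrt 2 * (real B)\<^sup>2)) = 1 / (4 * (real B)\<^sup>2)"
    by (simp add: N)
  finally show ?thesis unfolding eq .
qed

text \<open>Block \<open>N\<close> of the Fejer mean of order \<open>q\<close> is block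
  \<open>N\<close> of the error plus block \<open>N\<close> of the martingale. Convergence would
  make the first small, the second is O(1/N), but the sum stays bounded below.\<close>

theorem fejer_means_diverge:
  "\<exists>f \<in> Hp_space m (1/2).
     (\<exists>C>0. \<forall>\<^sub>F n in sequentially. Hp_modulus m (1/2) n f \<le> ennreal (C / real n ^ 2)) \<and>
     \<not> (\<lambda>n. mart_Lp_norm m (1/2) (mart_diff (mart_of m (fejer_mean m n f)) f)) \<longlonglongrightarrow> 0"
proof (intro bexI conjI)
  let ?c = lacunary_coeff
  let ?f = "partial_series ?c"
  have mart: "vmartingale m ?f" by (rule vmartingale_partial_series)
  have coeff: "mart_coeff m ?f = ?c" by (rule ext) (rule mart_coeff_partial_series)
  show "?f \<in> Hp_space m (1/2)"
    using mart max_root_lacunary_finite Hp_norm_eq[of ?f ?c]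
    by (simp add: Hp_space_def ennreal_mult_less_top)
  show "\<exists>C>0. \<forall>\<^sub>F n in sequentially. Hp_modulus m (1/2) n ?f \<le> ennreal (C / real n ^ 2)"
  proof (intro exI[of _ 16] conjI)
    show "\<forall>\<^sub>F n in sequentially. Hp_modulus m (1/2) n ?f \<le> ennreal (16 / real n ^ 2)"
      using eventually_gt_at_top[of 0]
    proof eventually_elim
      case (elim n)
      let ?t = "\<lambda>j. if j < M n then 0 else ?c j"
      have "Hp_modulus m (1/2) n ?f = max_root ?t * max_root ?t"
        unfolding Hp_modulus_def
        by (intro Hp_norm_eq) (simp only: modulus_eq_partial_series[OF mart] coeff)
      also have "\<dots> \<le> ennreal (4 / real n) * ennreal (4 / real n)"
        by (intro mult_mono max_root_lacunary_tail_le elim) auto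
      also have "\<dots> = ennreal (16 / real n ^ 2)"
        by (simp add: ennreal_mult[symmetric] power2_eq_square)
      finally show ?case .
    qed
  qed simp
  show "\<not> (\<lambda>n. mart_Lp_norm m (1/2) (mart_diff (mart_of m (fejer_mean m n ?f)) ?f)) \<longlonglongrightarrow> 0"
  proof
    assume lim: "(\<lambda>n. mart_Lp_norm m (1/2) (mart_diff (mart_of m (fejer_mean m n ?f)) ?f)) \<longlonglongrightarrow> 0"
    \<comment> \<open>\<open>4 * \<delta>\<close> is the lower bound of
      \<open>Lhalf_fejer_mean_lacunary_ge\<close>; two stages of the error and one block of the
      martingale use up less than that.\<close>
    define \<delta> where "\<delta> = 1 / (16 * (real B)\<^sup>2)"
    have \<delta>: "0 < \<delta>" using B_ge by (simp add: \<delta>_def)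
    have "\<forall>\<^sub>F n in sequentially.
        mart_Lp_norm m (1/2) (mart_diff (mart_of m (fejer_mean m n ?f)) ?f) < ennreal (\<delta> * \<delta>)"
      using \<delta> by (intro order_tendstoD(2)[OF lim]) simp
    then obtain n0 where n0: "\<And>n. n0 \<le> n \<Longrightarrow>
        mart_Lp_norm m (1/2) (mart_diff (mart_of m (fejer_mean m n ?f)) ?f) < ennreal (\<delta> * \<delta>)"
      by (auto simp: eventually_sequentially)
    \<comment> \<open>As \<open>N > k \<ge> k0\<close>, this makes \<open>2 / N\<close> smaller than
      \<open>\<delta>\<close>.\<close>
    obtain k0 where k0: "2 / \<delta> < real k0" using reals_Archimedean2 by blast
    define k where "k = max n0 k0"
    define N where "N = (2::nat) ^ Suc k"
    define q where "q = M N + even_index (2 ^ k)"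
    have kN: "k < N" using less_exp[of "Suc k"] unfolding N_def by linarith
    have "n0 \<le> q" using kN less_M[of N] by (simp add: q_def k_def)
    let ?d = "fejer_error ?c q"
    have small: "Lhalf (partial_series ?d l) \<le> \<delta>" for l
    proof -
      have "ennreal (Lhalf (partial_series ?d l)) * ennreal (Lhalf (partial_series ?d l))
          \<le> mart_Lp_norm m (1/2) (mart_diff (mart_of m (fejer_mean m q ?f)) ?f)"
        by (rule Lhalf_partial_series_le_mart_Lp_norm)
          (simp only: fejer_error_eq_partial_series[OF mart] coeff)
      also have "\<dots> \<le> ennreal \<delta> * ennreal \<delta>"
        using n0[OF \<open>n0 \<le> q\<close>] \<delta> by (simp add: ennreal_mult[symmetric])
      finally show ?thesis
        using \<delta> by (simp add: ennreal_mult_self_le_iff ennreal_le_iff)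
    qed
    have "block ?d N = (\<lambda>x. partial_series ?d (Suc N) x - partial_series ?d N x)"
      by (simp add: partial_series_Suc)
    then have "Lhalf (block ?d N) \<le> Lhalf (partial_series ?d (Suc N)) + Lhalf (partial_series ?d N)"
      using Lhalf_diff[OF cylindrical_partial_series cylindrical_mono[OF cylindrical_partial_series]]
      by simp
    with small[of "Suc N"] small[of N] have err: "Lhalf (block ?d N) \<le> 2 * \<delta>" by simp
    have "Lhalf (block ?c N) \<le> 2 / real N"
      by (rule order_trans[OF Lhalf_block_lacunary_le]) simp
    also have "\<dots> < \<delta>"
    proof -
      have "2 / \<delta> < real N" using k0 kN by (simp add: k_def)
      then show ?thesis using \<delta> kN by (simp add: field_simps)
    qed
    finally have c: "Lhalf (block ?c N) < \<delta>" .
    have "block (\<lambda>j. of_nat (q - j) / of_nat q * ?c j) N = (\<lambda>x. block ?d N x + block ?c N x)"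
      by (simp add: block_def[abs_def] fejer_error_def sum.distrib[symmetric] algebra_simps)
    then have "Lhalf (block (\<lambda>j. of_nat (q - j) / of_nat q * ?c j) N) \<le> Lhalf (block ?d N) + Lhalf (block ?c N)"
      using Lhalf_add[OF cylindrical_block cylindrical_block] by simp
    also have "\<dots> < 4 * \<delta>" using err c \<delta> by simp
    finally show False
      using Lhalf_fejer_mean_lacunary_ge[OF N_def q_def] by (simp add: \<delta>_def)
  qed
qed

end

theorem theorem3p24:
  fixes m :: "nat \<Rightarrow> nat"
  assumes "\<forall>k. 2 \<le> m k" and "bdd_above (range m)"
  shows "(\<forall>f \<in> Hp_space m (1/2).
            (\<forall>c>0. \<forall>\<^sub>F n in sequentially. Hp_modulus m (1/2) n f \<le> ennreal (c / real n ^ 2)) \<longrightarrow>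
            (\<lambda>n. Hp_norm m (1/2) (mart_diff (mart_of m (fejer_mean m n f)) f)) \<longlonglongrightarrow> 0) \<and>
         (\<exists>f \<in> Hp_space m (1/2).
            (\<exists>C>0. \<forall>\<^sub>F n in sequentially. Hp_modulus m (1/2) n f \<le> ennreal (C / real n ^ 2)) \<and>
            \<not> (\<lambda>n. mart_Lp_norm m (1/2) (mart_diff (mart_of m (fejer_mean m n f)) f)) \<longlonglongrightarrow> 0)"
proof -
  obtain B where "m k \<le> B" for k
    using assms(2) by (auto simp: bdd_above_def)
  then interpret vilenkin_system m B
    using assms(1) by unfold_locales auto
  show ?thesis
    using fejer_means_converge fejer_means_diverge by blast
qed

end
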